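(* For every $K>0$ there exists $N=N(K)\in\mathbb{N}$, and for every $\varepsilon\in(0,1/2)$ and $K>0$ there exists $D=D(K,\varepsilon)\in(1,\infty)$, such that for every separable metric space $(X,d)$ with doubling constant $K$, the metric space $(X,d^{1-\varepsilon})$ admits a bi-Lipschitz embedding into $\mathbb{R}^N$ with distortion at most $D$. (Thus $N$ depends only on $K$ and not on $\varepsilon$.)
   Context: All metric spaces contain at least two points. Balls are closed: $B(x,r)=\{y\in X: d(x,y)\le r\}$. A metric space $(X,d)$ has doubling constant $K\in(1,\infty)$ if for every $x\in X$ and $r>0$ there is $A\subseteq X$ with $|A|\le K$ and $B(x,r)\subseteq\bigcup_{y\in A}B(y,r/2)$ (since $X$ has at least two points, necessarily $K\ge 2$). A metric space $(X,\rho)$ embeds into a normed space $(Y,\|\cdot\|)$ with distortion $D$ if there is $f:X\to Y$ such that $\rho(x,y)\le\|f(x)-f(y)\|\le D\rho(x,y)$ for all $x,y\in X$. The space $\mathbb{R}^N$ carries the standard Euclidean norm. *)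

theory Defs
  imports "HOL-Analysis.Analysis"
begin

definition doubling_with :: "'a set \<Rightarrow> ('a \<Rightarrow> 'a \<Rightarrow> real) \<Rightarrow> real \<Rightarrow> bool" where
  "doubling_with X d K \<longleftrightarrow> 1 < K \<and>
     (\<forall>x\<in>X. \<forall>r>0. \<exists>A\<subseteq>X. finite A \<and> real (card A) \<le> K \<and>
        Metric_space.mcball X d x r \<subseteq> (\<Union>y\<in>A. Metric_space.mcball X d y (r / 2)))"

text \<open>The snowflake of \<open>d\<close> with exponent \<open>1 - \<epsilon>\<close>; the diagonal is unaffected since
  \<open>0 powr a = 0\<close>.\<close>

definition snowflake :: "('a \<Rightarrow> 'a \<Rightarrow> real) \<Rightarrow> real \<Rightarrow> 'a \<Rightarrow> 'a \<Rightarrow> real" where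
  "snowflake d \<epsilon> x y = d x y powr (1 - \<epsilon>)"

text \<open>Embedding of \<open>(X, \<rho>)\<close> into a normed space with underlying set \<open>Y\<close> and norm \<open>nrm\<close>. The target
  is given by a carrier because the dimension of the Euclidean target below is existentially
  quantified. The property is monotone in \<open>D\<close>, so it also expresses ``distortion at most \<open>D\<close>''.\<close>

definition embeds_with_distortion ::
  "'a set \<Rightarrow> ('a \<Rightarrow> 'a \<Rightarrow> real) \<Rightarrow> 'b::minus set \<Rightarrow> ('b \<Rightarrow> real) \<Rightarrow> real \<Rightarrow> bool" where
  "embeds_with_distortion X \<rho> Y nrm D \<longleftrightarrow>
     (\<exists>f \<in> X \<rightarrow> Y. \<forall>x\<in>X. \<forall>y\<in>X. \<rho> x y \<le> nrm (f x - f y) \<and> nrm (f x - f y) \<le> D * \<rho> x y)"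

text \<open>The set underlying \<open>\<real>\<^sup>N\<close> is \<open>topspace (Euclidean_space N)\<close>: the sequences
  \<open>v :: nat \<Rightarrow> real\<close> with \<open>v i = 0\<close> for \<open>i \<ge> N\<close>. Subtraction of sequences is pointwise.\<close>

definition euclidean_norm :: "nat \<Rightarrow> (nat \<Rightarrow> real) \<Rightarrow> real" where
  "euclidean_norm N v = L2_set v {..<N}"

text \<open>The embedding property for all metric spaces carried by subsets of the type \<open>'a\<close>. The locale
  \<^locale>\<open>Metric_space\<close> asks for symmetry and nonnegativity of \<open>d\<close> off the carrier as well; this
  is only a convention on irrelevant values.\<close>

definition snowflakes_embed :: "'a itself \<Rightarrow> real \<Rightarrow> real \<Rightarrow> nat \<Rightarrow> real \<Rightarrow> bool" where
  "snowflakes_embed (_ :: 'a itself) K \<epsilon> N D \<longleftrightarrow>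
     (\<forall>(X :: 'a set) d.
        Metric_space X d \<longrightarrow>
        (\<exists>x\<in>X. \<exists>y\<in>X. x \<noteq> y) \<longrightarrow>
        separable_space (Metric_space.mtopology X d) \<longrightarrow>
        doubling_with X d K \<longrightarrow>
        embeds_with_distortion X (snowflake d \<epsilon>)
          (topspace (Euclidean_space N)) (euclidean_norm N) D)"

text \<open>HOL has no quantification over types inside a formula, so ``\<open>N\<close> and \<open>D\<close> work for every
  separable metric space'' is rendered in two steps: numbers \<open>N\<close> and \<open>D\<close> are found for the metric
  spaces with points in \<^typ>\<open>real\<close>, which does not mention the type variable \<open>'a\<close>, and any such
  numbers are asserted to work verbatim for the metric spaces with points in an arbitrary type
  \<open>'a\<close>. Quantifying \<open>N\<close> and \<open>D\<close> in a statement about \<open>'a\<close> alone would let them depend on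
  \<open>'a\<close>. The type \<^typ>\<open>real\<close> is chosen because a separable metric space has at most continuum many
  points, so each is isometric to one of this kind.\<close>

end

theory Submission
  imports Defs
begin

text \<open>The argument is the deterministic one of David and Snipes. Maps \<open>F\<^sub>k\<close> are built scale by scale for
  \<open>r\<^sub>k = s / q\<^sup>k\<close>, adding to each coordinate a combination of bumps of width \<open>r\<^sub>k\<close> and height at most
  \<open>r\<^sub>k\<close> to the power \<open>\<alpha> = 1 - \<epsilon>\<close>, centred at an \<open>r\<^sub>k\<close>-net. The coefficients are chosen greedily from the grid
  of \<open>Q\<^sup>m\<close> labels so that points at distance between \<open>10 r\<^sub>k\<close> and \<open>10 q r\<^sub>k\<close> are separated. With \<open>q\<close> equal to
  the sixth power of \<open>Q\<close>, the number of constraints on one coefficient is polynomial in \<open>Q\<close> with exponent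
  controlled by the doubling constant alone, so a dimension \<open>m\<close> independent of \<open>\<epsilon>\<close> suffices; \<open>\<epsilon>\<close> only
  forces \<open>Q\<close>, hence the distortion, to be large. The finer scales do not destroy the separation because \<open>\<alpha> \<ge> 1/2\<close>.
  Maps that are good for scales in \<open>[1/n, n]\<close> have a cluster point by Tychonoff's theorem.\<close>

section \<open>Greedy choices along a well-order, and counting by injection\<close>

text \<open>Transfinite recursion along a well-order of the whole type: each index takes a label
  that is not bad and does not conflict with its predecessors. Since \<open>avail\<close> covers
  every labelling \<open>v\<close>, it applies to the one built so far; \<open>sym\<close> reduces a
  conflict with a later index to one with an earlier index.\<close>

lemma greedy_labelling:
  fixes conf :: "'a \<Rightarrow> 'c \<Rightarrow> 'a \<Rightarrow> 'c \<Rightarrow> bool"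
  assumes sym: "\<And>i c j c'. conf i c j c' \<Longrightarrow> conf j c' i c"
    and avail: "\<And>j v. j \<in> J \<Longrightarrow> \<exists>c\<in>C. \<not> bad j c \<and> (\<forall>i\<in>J - {j}. \<not> conf i (v i) j c)"
  obtains v where "\<And>j. j \<in> J \<Longrightarrow> v j \<in> C \<and> \<not> bad j (v j)"
    and "\<And>i j. i \<in> J \<Longrightarrow> j \<in> J \<Longrightarrow> i \<noteq> j \<Longrightarrow> \<not> conf i (v i) j (v j)"
proof -
  obtain r :: "'a rel" where r: "Well_order r" "Field r = UNIV"
    using well_ordering[where 'a = 'a] by (elim exE conjE)
  define R where "R = r - Id"
  have wfR: "wf R"
    using r(1) unfolding R_def well_order_on_def by blast
  have irrefl: "(i, i) \<notin> R" for i
    by (simp add: R_def)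
  have total: "(i, j) \<in> R \<or> (j, i) \<in> R" if "i \<noteq> j" for i j
    using r that unfolding R_def well_order_on_def linear_order_on_def total_on_def by blast
  \<comment> \<open>Only labels of \<open>R\<close>-predecessors enter, so \<open>P\<close> is a
    legitimate recursion condition for \<open>dependent_wf_choice\<close>. Off \<open>J\<close>
    every value is allowed.\<close>
  define P where "P f j c \<longleftrightarrow> (j \<in> J \<longrightarrow>
      c \<in> C \<and> \<not> bad j c \<and> (\<forall>i\<in>J. (i, j) \<in> R \<longrightarrow> \<not> conf i (f i) j c))" for f j c
  have "\<exists>f. \<forall>x. P f x (f x)"
  proof (rule dependent_wf_choice[OF wfR])
    show "P f x c = P g x c" if "\<And>z. (z, x) \<in> R \<Longrightarrow> f z = g z" for f g x c
      using that unfolding P_def by metis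
    show "\<exists>c. P f x c" for f x
    proof (cases "x \<in> J")
      case True
      then obtain c where "c \<in> C" "\<not> bad x c" "\<forall>i\<in>J - {x}. \<not> conf i (f i) x c"
        using avail[of x f] by auto
      then have "P f x c"
        using irrefl by (auto simp: P_def)
      then show ?thesis ..
    qed (auto simp: P_def)
  qed
  then obtain v where v: "P v j (v j)" for j
    by blast
  show ?thesis
  proof
    show "v j \<in> C \<and> \<not> bad j (v j)" if "j \<in> J" for j
      using v[of j] that by (simp add: P_def)
    show "\<not> conf i (v i) j (v j)" if "i \<in> J" "j \<in> J" "i \<noteq> j" for i j
      using total[OF that(3)]
    proof
      assume "(i, j) \<in> R"
      then show ?thesis
        using v[of j] that by (simp add: P_def)
    next
      assume "(j, i) \<in> R"
      then have "\<not> conf j (v j) i (v i)"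
        using v[of i] that by (simp add: P_def)
      then show ?thesis
        using sym by blast
    qed
  qed
qed

text \<open>Bounds a set by the size of a net: each element leaves a trace at some net point (or
  pair of net points), and elements with the same trace coincide.\<close>

lemma card_le_if_injective_witness:
  assumes "finite T" "\<And>c. c \<in> A \<Longrightarrow> \<exists>t\<in>T. W c t"
    and "\<And>c c' t. c \<in> A \<Longrightarrow> c' \<in> A \<Longrightarrow> W c t \<Longrightarrow> W c' t \<Longrightarrow> c = c'"
  shows "finite A \<and> card A \<le> card T"
proof -
  obtain g where g: "\<And>c. c \<in> A \<Longrightarrow> g c \<in> T \<and> W c (g c)"
    using assms(2) by metis
  have "inj_on g A"
    using g assms(3) by (metis inj_onI)
  then show ?thesis
    using g assms(1) by (auto intro: inj_on_finite card_inj_on_le)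
qed

section \<open>Covers, separated nets and bumps in a doubling space\<close>

locale doubling_metric = Metric_space M d for M :: "'a set" and d +
  fixes \<kappa> :: nat
  assumes doubling: "x \<in> M \<Longrightarrow> 0 < r \<Longrightarrow> \<exists>A\<subseteq>M. finite A \<and> card A \<le> 2 ^ \<kappa> \<and>
    mcball x r \<subseteq> (\<Union>y\<in>A. mcball y (r / 2))"
begin

text \<open>Halve the radius \<open>n\<close> times, covering each ball of a generation separately;
  every halving multiplies the number of balls by at most \<open>2 ^ \<kappa>\<close>.\<close>

lemma cover_mcball:
  assumes "x \<in> M" "0 < r"
  shows "\<exists>A\<subseteq>M. finite A \<and> card A \<le> 2 ^ (\<kappa> * n) \<and> mcball x (2 ^ n * r) \<subseteq> (\<Union>y\<in>A. mcball y r)"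
  using \<open>x \<in> M\<close>
proof (induction n arbitrary: x)
  case 0
  then show ?case
    by (intro exI[of _ "{x}"]) auto
next
  case (Suc n)
  obtain A where A: "A \<subseteq> M" "finite A" "card A \<le> 2 ^ \<kappa>"
      "mcball x (2 ^ Suc n * r) \<subseteq> (\<Union>y\<in>A. mcball y (2 ^ Suc n * r / 2))"
    using doubling[OF Suc.prems, of "2 ^ Suc n * r"] assms by auto
  have "\<forall>y\<in>A. \<exists>B\<subseteq>M. finite B \<and> card B \<le> 2 ^ (\<kappa> * n) \<and> mcball y (2 ^ n * r) \<subseteq> (\<Union>z\<in>B. mcball z r)"
    using Suc.IH A(1) by blast
  then obtain B where B: "\<And>y. y \<in> A \<Longrightarrow> B y \<subseteq> M \<and> finite (B y) \<and> card (B y) \<le> 2 ^ (\<kappa> * n) \<and>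
      mcball y (2 ^ n * r) \<subseteq> (\<Union>z\<in>B y. mcball z r)"
    by metis
  show ?case
  proof (intro exI[of _ "\<Union>y\<in>A. B y"] conjI)
    have "card (\<Union>y\<in>A. B y) \<le> (\<Sum>y\<in>A. card (B y))"
      by (rule card_UN_le[OF A(2)])
    also have "\<dots> \<le> card A * 2 ^ (\<kappa> * n)"
      using sum_bounded_above[of A "\<lambda>y. card (B y)" "2 ^ (\<kappa> * n)"] B by simp
    also have "\<dots> \<le> 2 ^ \<kappa> * 2 ^ (\<kappa> * n)"
      using A(3) by (rule mult_right_mono) simp
    finally show "card (\<Union>y\<in>A. B y) \<le> 2 ^ (\<kappa> * Suc n)"
      by (simp add: power_add)
    show "mcball x (2 ^ Suc n * r) \<subseteq> (\<Union>y\<in>(\<Union>y\<in>A. B y). mcball y r)"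
    proof
      fix p assume "p \<in> mcball x (2 ^ Suc n * r)"
      then obtain y where "y \<in> A" "p \<in> mcball y (2 ^ n * r)"
        using A(4) by auto
      then show "p \<in> (\<Union>y\<in>(\<Union>y\<in>A. B y). mcball y r)"
        using B[of y] by blast
    qed
  qed (use A(2) B in blast)+
qed

text \<open>A point is kept iff it is at distance at least \<open>r\<close> from all points kept
  before it in a well-order. A rejected point owes its rejection to a kept one closer than
  \<open>r\<close>, which gives density.\<close>

lemma maximal_separated:
  assumes "0 < r"
  obtains S where "S \<subseteq> M" "\<And>x y. x \<in> S \<Longrightarrow> y \<in> S \<Longrightarrow> x \<noteq> y \<Longrightarrow> r \<le> d x y"
    "\<And>x. x \<in> M \<Longrightarrow> \<exists>y\<in>S. d x y < r"
proof -
  obtain le :: "'a rel" where le: "Well_order le" "Field le = UNIV"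
    using well_ordering[where 'a = 'a] by (elim exE conjE)
  define R where "R = le - Id"
  have wfR: "wf R"
    using le(1) unfolding R_def well_order_on_def by blast
  have total: "(i, j) \<in> R \<or> (j, i) \<in> R" if "i \<noteq> j" for i j
    using le that unfolding R_def well_order_on_def linear_order_on_def total_on_def by blast
  define P where "P f x b \<longleftrightarrow> (b \<longleftrightarrow> x \<in> M \<and> (\<forall>z. (z, x) \<in> R \<and> f z \<longrightarrow> r \<le> d z x))" for f x b
  have "\<exists>f. \<forall>x. P f x (f x)"
  proof (rule dependent_wf_choice[OF wfR])
    show "P f x c = P g x c" if "\<And>z. (z, x) \<in> R \<Longrightarrow> f z = g z" for f g x c
      using that unfolding P_def by metis
  qed (auto simp: P_def)
  then obtain f where f: "f x \<longleftrightarrow> x \<in> M \<and> (\<forall>z. (z, x) \<in> R \<and> f z \<longrightarrow> r \<le> d z x)" for x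
    unfolding P_def by blast
  show ?thesis
  proof (rule that[of "{x. f x}"])
    show "{x. f x} \<subseteq> M"
    proof
      show "x \<in> M" if "x \<in> {x. f x}" for x
        using f[of x] that by simp
    qed
    show "r \<le> d x y" if "x \<in> {x. f x}" "y \<in> {x. f x}" "x \<noteq> y" for x y
      using total[OF that(3)]
    proof
      assume "(x, y) \<in> R"
      then show ?thesis
        using f[of y] that by auto
    next
      assume "(y, x) \<in> R"
      then show ?thesis
        using f[of x] that by (auto simp: commute)
    qed
    show "\<exists>y\<in>{x. f x}. d x y < r" if "x \<in> M" for x
    proof (cases "f x")
      case True
      then show ?thesis
        using that assms by (intro bexI[of _ x]) auto
    next
      case False
      then obtain z where "f z" "d z x < r"
        using f[of x] \<open>x \<in> M\<close> by (auto simp: not_le)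
      then show ?thesis
        by (intro bexI[of _ z]) (auto simp: commute)
    qed
  qed
qed

text \<open>Greedy colouring of the graph that joins net points at distance below
  \<open>10 * r\<close>. A ball of radius \<open>16 * r = 2 ^ 6 * (r / 4)\<close> is covered by
  \<open>2 ^ (6 * \<kappa>)\<close> balls of radius \<open>r / 4\<close>, each holding at most one
  net point, so with one more colour than this some colour is always free.\<close>

lemma coloured_net:
  assumes "0 < r"
  obtains S col where "S \<subseteq> M" "\<And>x. x \<in> M \<Longrightarrow> \<exists>y\<in>S. d x y < r"
    "\<And>x. x \<in> S \<Longrightarrow> col x < (2::nat) ^ (6 * \<kappa>) + 1"
    "\<And>x y. x \<in> S \<Longrightarrow> y \<in> S \<Longrightarrow> x \<noteq> y \<Longrightarrow> col x = col y \<Longrightarrow> 10 * r \<le> d x y"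
proof -
  obtain S where S: "S \<subseteq> M" "\<And>x y. x \<in> S \<Longrightarrow> y \<in> S \<Longrightarrow> x \<noteq> y \<Longrightarrow> r \<le> d x y"
      "\<And>x. x \<in> M \<Longrightarrow> \<exists>y\<in>S. d x y < r"
    using maximal_separated[OF assms] by blast
  define conf :: "'a \<Rightarrow> nat \<Rightarrow> 'a \<Rightarrow> nat \<Rightarrow> bool"
    where "conf i c j c' \<longleftrightarrow> d i j < 10 * r \<and> c = c'" for i c j c'
  have avail: "\<exists>c\<in>{..<2 ^ (6 * \<kappa>) + 1}. \<not> False \<and> (\<forall>i\<in>S - {j}. \<not> conf i (v i) j c)"
    if j: "j \<in> S" for j v
  proof -
    define I where "I = {i \<in> S. d i j < 10 * r}"
    have "j \<in> M"
      using j S by auto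
    then obtain T where T: "T \<subseteq> M" "finite T" "card T \<le> 2 ^ (\<kappa> * 6)"
        "mcball j (2 ^ 6 * (r / 4)) \<subseteq> (\<Union>y\<in>T. mcball y (r / 4))"
      using cover_mcball[of j "r / 4" 6] assms by auto
    have I: "finite I" "card I \<le> card T"
    proof -
      have 1: "\<exists>t\<in>T. i \<in> mcball t (r / 4)" if "i \<in> I" for i
      proof -
        have "i \<in> mcball j (2 ^ 6 * (r / 4))"
          using that S j assms by (auto simp: I_def commute)
        then show ?thesis
          using T(4) by blast
      qed
      have 2: "i = i'" if "i \<in> I" "i' \<in> I" "i \<in> mcball t (r / 4)" "i' \<in> mcball t (r / 4)" for i i' t
      proof (rule ccontr)
        assume "i \<noteq> i'"
        then have "r \<le> d i i'"
          using that S by (auto simp: I_def)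
        moreover have "d i i' \<le> d i t + d t i'"
          using that by (intro triangle) auto
        ultimately show False
          using that assms by (simp add: commute)
      qed
      have "finite I \<and> card I \<le> card T"
        by (rule card_le_if_injective_witness[OF T(2), where W = "\<lambda>i t. i \<in> mcball t (r / 4)"])
          (use 1 2 in blast)+
      then show "finite I" "card I \<le> card T"
        by auto
    qed
    have "card (v ` I) \<le> 2 ^ (6 * \<kappa>)"
      using card_image_le[OF I(1), of v] I(2) T(3) by (simp add: mult.commute)
    then have "\<not> {..<2 ^ (6 * \<kappa>) + 1} \<subseteq> v ` I"
      using card_mono[of "v ` I" "{..<2 ^ (6 * \<kappa>) + 1}"] I(1) by auto
    then obtain c where "c \<in> {..<2 ^ (6 * \<kappa>) + 1}" "c \<notin> v ` I"
      by blast
    then show ?thesis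
      by (intro bexI[of _ c]) (auto simp: conf_def I_def)
  qed
  obtain col where col: "\<And>j. j \<in> S \<Longrightarrow> col j \<in> {..<2 ^ (6 * \<kappa>) + 1} \<and> \<not> False"
      "\<And>i j. i \<in> S \<Longrightarrow> j \<in> S \<Longrightarrow> i \<noteq> j \<Longrightarrow> \<not> conf i (col i) j (col j)"
  proof (rule greedy_labelling[of conf S "{..<2 ^ (6 * \<kappa>) + 1}" "\<lambda>_ _. False"])
    show "conf j c' i c" if "conf i c j c'" for i c j c'
      using that by (simp add: conf_def commute)
  qed (use avail in blast)+
  show ?thesis
  proof (rule that[of S col])
    show "10 * r \<le> d x y" if "x \<in> S" "y \<in> S" "x \<noteq> y" "col x = col y" for x y
      using col(2)[OF that(1-3)] that(4) by (simp add: conf_def)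
    show "col x < 2 ^ (6 * \<kappa>) + 1" if "x \<in> S" for x
      using col(1)[OF that] by simp
  qed (fact S(1) S(3))+
qed

text \<open>Trapezoidal cutoff around \<open>j\<close>. The plateau \<open>d x j \<le> r\<close>
  lets every point near \<open>j\<close> see the full coefficient attached to
  \<open>j\<close>.\<close>

definition bump :: "real \<Rightarrow> 'a \<Rightarrow> 'a \<Rightarrow> real" where
  "bump r j x = max 0 (min 1 (2 - d x j / r))"

lemma bump_bounds: "0 \<le> bump r j x" "bump r j x \<le> 1"
  by (auto simp: bump_def)

lemma bump_eq_1: "0 < r \<Longrightarrow> d x j \<le> r \<Longrightarrow> bump r j x = 1"
  by (auto simp: bump_def field_simps)

lemma bump_eq_0: "0 < r \<Longrightarrow> 2 * r \<le> d x j \<Longrightarrow> bump r j x = 0"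
  by (auto simp: bump_def field_simps)

lemma bump_pos: "0 < r \<Longrightarrow> 0 < bump r j x \<Longrightarrow> d x j < 2 * r"
  using bump_eq_0[of r x j] by force

lemma bump_lipschitz:
  assumes "0 < r" "x \<in> M" "y \<in> M" "j \<in> M"
  shows "\<bar>bump r j x - bump r j y\<bar> \<le> d x y / r"
proof -
  have "\<bar>d x j - d y j\<bar> \<le> d x y"
    using triangle[of x y j] triangle[of y x j] assms by (auto simp: commute)
  then have "\<bar>d x j - d y j\<bar> / r \<le> d x y / r"
    using assms(1) by (intro divide_right_mono) auto
  moreover have "\<bar>(2 - d x j / r) - (2 - d y j / r)\<bar> = \<bar>d x j - d y j\<bar> / r"
    using assms(1) by (simp add: abs_minus_commute diff_divide_distrib[symmetric] abs_divide)
  ultimately have "\<bar>(2 - d x j / r) - (2 - d y j / r)\<bar> \<le> d x y / r"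
    by simp
  then show ?thesis
    unfolding bump_def by linarith
qed

section \<open>Separation at a single scale\<close>

text \<open>Treats one colour class \<open>J\<close>. The map \<open>f\<close> is a sum of bumps
  with disjoint supports, with coefficient vectors taken from the multiples of \<open>1 / Q\<close>
  below 1; \<open>G\<close> stands for the coarser scales, rescaled so that the new bumps have
  height at most 1. The greedy choice succeeds because the constraints on one label are indexed by
  pairs of points of a finite net: they forbid at most \<open>2 * Q ^ (18 * \<kappa>)\<close> of the
  \<open>Q ^ (18 * \<kappa> + 2)\<close> labels.\<close>

lemma separating_step:
  fixes G :: "nat \<Rightarrow> 'a \<Rightarrow> real" and Q :: nat
  assumes r: "0 < r" and a: "12 \<le> a" and Q: "Q = 2 ^ a"
    and J: "J \<subseteq> M" "\<And>i j. i \<in> J \<Longrightarrow> j \<in> J \<Longrightarrow> i \<noteq> j \<Longrightarrow> 10 * r \<le> d i j"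
    and G: "\<And>m x y. m < 18 * \<kappa> + 2 \<Longrightarrow> x \<in> M \<Longrightarrow> y \<in> M \<Longrightarrow> \<bar>G m x - G m y\<bar> \<le> d x y / r"
  obtains f where "\<And>m x. m < 18 * \<kappa> + 2 \<Longrightarrow> x \<in> M \<Longrightarrow> 0 \<le> f m x \<and> f m x \<le> 1"
    and "\<And>m x y. m < 18 * \<kappa> + 2 \<Longrightarrow> x \<in> M \<Longrightarrow> y \<in> M \<Longrightarrow> \<bar>f m x - f m y\<bar> \<le> d x y / r"
    and "\<And>j x y. j \<in> J \<Longrightarrow> x \<in> M \<Longrightarrow> y \<in> M \<Longrightarrow> d x j \<le> r \<Longrightarrow> 10 * r \<le> d x y \<Longrightarrow>
      d x y \<le> 10 * real Q ^ 6 * r \<Longrightarrow>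
      \<exists>m<18 * \<kappa> + 2. 1 / (64 * (real Q)\<^sup>2) \<le> \<bar>(G m x + f m x) - (G m y + f m y)\<bar>"
proof -
  define D where "D = 18 * \<kappa> + 2"
  \<comment> \<open>Distinct labels differ by at least \<open>1 / Q\<close> in some coordinate.
    \<open>\<delta>\<close> is the separation to be reached, \<open>\<theta>\<close> the bump height
    below which a label is ignored, and \<open>\<eta> * r\<close> the mesh of the net on which
    constraints are counted. They are tuned to
    \<open>2 * (\<delta> + \<theta>) + 4 * \<eta> < 1 / Q\<close> and
    \<open>2 * \<delta> + 8 * \<eta> < \<theta> / Q\<close>.\<close>
  define \<delta> \<theta> \<eta> where "\<delta> = 1 / (64 * (real Q)\<^sup>2)" and "\<theta> = 1 / (8 * real Q)"
    and "\<eta> = 1 / (256 * (real Q)\<^sup>2)"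
  define C where "C = ({..<D} \<rightarrow>\<^sub>E {..<Q})"
  define R where "R = 10 * real Q ^ 6 * r"
  have Q4096: "4096 \<le> Q"
    using power_increasing[OF a, of "2::nat"] by (simp add: Q)
  have pos: "0 < \<delta>" "0 < \<theta>" "\<theta> \<le> 1" "0 < \<eta>"
    using Q4096 by (auto simp: \<delta>_def \<theta>_def \<eta>_def)
  have C: "finite C" "card C = Q ^ D"
    by (auto simp: C_def card_PiE finite_PiE)
  have label_le: "real (c m) / real Q \<le> 1" "0 \<le> real (c m) / real Q" if "c \<in> C" "m < D" for c m
  proof -
    have "c m < Q"
      using that by (auto simp: C_def PiE_iff)
    then show "real (c m) / real Q \<le> 1" "0 \<le> real (c m) / real Q"
      by auto
  qed
  have label_eq: "c = c'"
    if CC: "c \<in> C" "c' \<in> C" and diff: "\<And>m. m < D \<Longrightarrow> \<bar>real (c m) / real Q - real (c' m) / real Q\<bar> < 1 / real Q"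
    for c c'
  proof -
    have "c m = c' m" if m: "m < D" for m
    proof -
      have "\<bar>real (c m) - real (c' m)\<bar> / real Q < 1 / real Q"
        using diff[OF m] Q4096 by (simp add: diff_divide_distrib[symmetric])
      then have "\<bar>real (c m) - real (c' m)\<bar> < 1"
        using Q4096 by (simp add: divide_less_cancel)
      then show ?thesis
        by linarith
    qed
    then show ?thesis
      using CC unfolding C_def by (intro PiE_ext) auto
  qed
  txt \<open>A label conflict with a bump of height below \<open>\<theta>\<close> at \<open>y\<close> is negligible and is absorbed into the margin
    \<open>\<delta> + \<theta>\<close> of \<open>bad\<close>; above \<open>\<theta>\<close>, a fixed label at one centre excludes few labels at the other.\<close>
  define bad where "bad j c \<longleftrightarrow> (\<exists>x\<in>M. \<exists>y\<in>M. d x j \<le> r \<and> d x y \<le> R \<and>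
      (\<forall>m<D. \<bar>(G m x + real (c m) / real Q) - G m y\<bar> < \<delta> + \<theta>))" for j and c :: "nat \<Rightarrow> nat"
  define close where "close i c' j c x y \<longleftrightarrow> \<theta> \<le> bump r i x \<and> \<theta> \<le> bump r j y \<and>
      (\<forall>m<D. \<bar>(G m x + bump r i x * (real (c' m) / real Q)) -
               (G m y + bump r j y * (real (c m) / real Q))\<bar> < \<delta>)"
    for i and c' :: "nat \<Rightarrow> nat" and j and c :: "nat \<Rightarrow> nat" and x y
  define conf where "conf i c' j c \<longleftrightarrow> c' \<in> C \<and> c \<in> C \<and> (\<exists>x\<in>M. \<exists>y\<in>M. d x y \<le> R \<and> close i c' j c x y)"
    for i and c' :: "nat \<Rightarrow> nat" and j and c :: "nat \<Rightarrow> nat"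
  have near_ball: "d x x' \<le> 2 * \<eta> * r" if "x \<in> mcball s (\<eta> * r)" "x' \<in> mcball s (\<eta> * r)" for x x' s
    using triangle[of x s x'] that by (auto simp: commute)
  have near_G: "\<bar>G m x - G m x'\<bar> \<le> 2 * \<eta>"
    if "x \<in> mcball s (\<eta> * r)" "x' \<in> mcball s (\<eta> * r)" "m < D" for x x' s m
  proof -
    have "\<bar>G m x - G m x'\<bar> \<le> d x x' / r"
      using that G by (auto simp: D_def)
    also have "\<dots> \<le> 2 * \<eta>"
      using near_ball[OF that(1,2)] r by (simp add: field_simps)
    finally show ?thesis .
  qed
  have near_bump: "\<bar>bump r j x - bump r j x'\<bar> \<le> 2 * \<eta>"
    if "x \<in> mcball s (\<eta> * r)" "x' \<in> mcball s (\<eta> * r)" "j \<in> M" for x x' s j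
  proof -
    have "\<bar>bump r j x - bump r j x'\<bar> \<le> d x x' / r"
      using that r by (auto intro: bump_lipschitz)
    also have "\<dots> \<le> 2 * \<eta>"
      using near_ball[OF that(1,2)] r by (simp add: field_simps)
    finally show ?thesis .
  qed
  have conf_sym: "conf j c' i c" if "conf i c j c'" for i c j c'
  proof -
    obtain x y where xy: "x \<in> M" "y \<in> M" "d x y \<le> R" "close i c j c' x y" "c \<in> C" "c' \<in> C"
      using \<open>conf i c j c'\<close> by (auto simp: conf_def)
    have "close j c' i c y x"
      using xy(4) unfolding close_def by (metis abs_minus_commute)
    then show ?thesis
      using xy unfolding conf_def by (metis commute)
  qed
  have avail: "\<exists>c\<in>C. \<not> bad j c \<and> (\<forall>i\<in>J - {j}. \<not> conf i (v i) j c)" if j: "j \<in> J" for j v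
  proof -
    have jM: "j \<in> M"
      using j J(1) by auto
    \<comment> \<open>In every constraint on \<open>j\<close> one point lies within
      \<open>2 * r\<close> of \<open>j\<close> and the other within \<open>R\<close> of the first,
      so this ball holds both. The estimate needs \<open>16 \<le> Q / 256\<close>, which is what
      \<open>12 \<le> a\<close> provides.\<close>
    have radius: "R + 4 * r \<le> 2 ^ (9 * a) * (\<eta> * r)"
    proof -
      have "1 \<le> real Q ^ 6"
        using Q4096 by (intro one_le_power) simp
      then have "10 * real Q ^ 6 + 4 \<le> 16 * real Q ^ 6"
        by linarith
      also have "\<dots> \<le> real Q ^ 6 * (real Q * (1 / 256))"
        using Q4096 by (subst mult.commute) (intro mult_left_mono, auto)
      also have "\<dots> = real Q ^ 9 * \<eta>"
      proof -
        have "real Q ^ 9 = real Q ^ 6 * real Q * (real Q)\<^sup>2"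
          by (simp add: numeral_eq_Suc)
        then show ?thesis
          using Q4096 by (simp add: \<eta>_def)
      qed
      also have "real Q ^ 9 = 2 ^ (9 * a)"
        by (simp add: Q power_mult[symmetric] mult.commute)
      finally have "(10 * real Q ^ 6 + 4) * r \<le> (2 ^ (9 * a) * \<eta>) * r"
        using r by (intro mult_right_mono) auto
      then show ?thesis
        by (simp add: R_def distrib_right mult.assoc)
    qed
    obtain T where T: "T \<subseteq> M" "finite T" "card T \<le> 2 ^ (\<kappa> * (9 * a))"
        "mcball j (2 ^ (9 * a) * (\<eta> * r)) \<subseteq> (\<Union>y\<in>T. mcball y (\<eta> * r))"
      using cover_mcball[OF jM, of "\<eta> * r" "9 * a"] r pos by auto
    have netpoint: "\<exists>t\<in>T. x \<in> mcball t (\<eta> * r)" if "x \<in> M" "d x j \<le> R + 4 * r" for x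
    proof -
      have "x \<in> mcball j (2 ^ (9 * a) * (\<eta> * r))"
        using that jM radius by (auto simp: commute)
      then show ?thesis
        using T(4) by blast
    qed
    have R0: "0 \<le> R"
      using r by (simp add: R_def)
    \<comment> \<open>The labels excluded by \<open>bad\<close> and by conflicts, respectively. Each
      label is sent to a pair of net points near the responsible \<open>x\<close> and
      \<open>y\<close>; both sets are shown to inject into \<open>T \<times> T\<close>.\<close>
    define B1 where "B1 = {c \<in> C. bad j c}"
    define B2 where "B2 = {c \<in> C. \<exists>i\<in>J - {j}. conf i (v i) j c}"
    define W1 where "W1 c st \<longleftrightarrow> (\<exists>x y. x \<in> mcball (fst st) (\<eta> * r) \<and> y \<in> mcball (snd st) (\<eta> * r) \<and>
        (\<forall>m<D. \<bar>(G m x + real (c m) / real Q) - G m y\<bar> < \<delta> + \<theta>))"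
      for c :: "nat \<Rightarrow> nat" and st
    define W2 where "W2 c st \<longleftrightarrow> (\<exists>x y i. x \<in> mcball (fst st) (\<eta> * r) \<and> y \<in> mcball (snd st) (\<eta> * r) \<and>
        i \<in> J - {j} \<and> v i \<in> C \<and> close i (v i) j c x y)"
      for c :: "nat \<Rightarrow> nat" and st
    have "finite B1 \<and> card B1 \<le> card (T \<times> T)"
    proof (rule card_le_if_injective_witness[where W = W1])
      show "\<exists>st\<in>T \<times> T. W1 c st" if "c \<in> B1" for c
      proof -
        obtain x y where xy: "x \<in> M" "y \<in> M" "d x j \<le> r" "d x y \<le> R"
            "\<forall>m<D. \<bar>(G m x + real (c m) / real Q) - G m y\<bar> < \<delta> + \<theta>"
          using \<open>c \<in> B1\<close> by (auto simp: B1_def bad_def)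
        have "d y j \<le> R + 4 * r"
          using triangle[of y x j] xy jM r by (simp add: commute)
        then obtain s t where "s \<in> T" "x \<in> mcball s (\<eta> * r)" "t \<in> T" "y \<in> mcball t (\<eta> * r)"
          using netpoint[of x] netpoint[of y] xy r R0 by fastforce
        then show ?thesis
          using xy(5) unfolding W1_def by (intro bexI[of _ "(s, t)"]) auto
      qed
      \<comment> \<open>Replacing \<open>x\<close>, \<open>y\<close> by points near the same net
        points moves each value of \<open>G\<close> by at most \<open>2 * \<eta>\<close>, so two bad
        labels with the same pair differ by less than \<open>1 / Q\<close> in every
        coordinate.\<close>
      show "c = c'" if "c \<in> B1" "c' \<in> B1" "W1 c st" "W1 c' st" for c c' st
      proof (rule label_eq)
        obtain x y where xy: "x \<in> mcball (fst st) (\<eta> * r)" "y \<in> mcball (snd st) (\<eta> * r)"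
            "\<forall>m<D. \<bar>(G m x + real (c m) / real Q) - G m y\<bar> < \<delta> + \<theta>"
          using \<open>W1 c st\<close> by (auto simp: W1_def)
        obtain x' y' where xy': "x' \<in> mcball (fst st) (\<eta> * r)" "y' \<in> mcball (snd st) (\<eta> * r)"
            "\<forall>m<D. \<bar>(G m x' + real (c' m) / real Q) - G m y'\<bar> < \<delta> + \<theta>"
          using \<open>W1 c' st\<close> by (auto simp: W1_def)
        have small: "2 * (\<delta> + \<theta>) + 4 * \<eta> < 1 / real Q"
          using Q4096 by (simp add: \<delta>_def \<theta>_def \<eta>_def power2_eq_square field_simps)
        show "\<bar>real (c m) / real Q - real (c' m) / real Q\<bar> < 1 / real Q" if m: "m < D" for m
        proof -
          define p p' where "p = real (c m) / real Q" and "p' = real (c' m) / real Q"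
          have "\<bar>(G m x + p) - G m y\<bar> < \<delta> + \<theta>" "\<bar>(G m x' + p') - G m y'\<bar> < \<delta> + \<theta>"
            using xy(3) xy'(3) m by (auto simp: p_def p'_def)
          then have "\<bar>p - p'\<bar> < 2 * (\<delta> + \<theta>) + 4 * \<eta>"
            using near_G[OF xy(1) xy'(1) m] near_G[OF xy(2) xy'(2) m] unfolding abs_less_iff abs_le_iff by auto
          then show ?thesis
            using small unfolding p_def p'_def by (rule less_trans)
        qed
      qed (use that in \<open>auto simp: B1_def\<close>)
    qed (use T in auto)
    moreover have "finite B2 \<and> card B2 \<le> card (T \<times> T)"
    proof (rule card_le_if_injective_witness[where W = W2])
      show "\<exists>st\<in>T \<times> T. W2 c st" if "c \<in> B2" for c
      proof -
        obtain x y i where xy: "x \<in> M" "y \<in> M" "d x y \<le> R" "i \<in> J - {j}" "v i \<in> C" "close i (v i) j c x y"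
          using \<open>c \<in> B2\<close> by (auto simp: B2_def conf_def)
        have y2: "d y j < 2 * r"
          using xy(6) pos r by (intro bump_pos) (auto simp: close_def)
        then have "d x j \<le> R + 4 * r"
          using triangle[of x y j] xy jM r by simp
        then obtain s t where "s \<in> T" "x \<in> mcball s (\<eta> * r)" "t \<in> T" "y \<in> mcball t (\<eta> * r)"
          using netpoint[of x] netpoint[of y] xy y2 r R0 by fastforce
        then show ?thesis
          using xy(4-6) unfolding W2_def by (intro bexI[of _ "(s, t)"]) auto
      qed
      show "c = c'" if "c \<in> B2" "c' \<in> B2" "W2 c st" "W2 c' st" for c c' st
      proof (rule label_eq)
        obtain x y i where xy: "x \<in> mcball (fst st) (\<eta> * r)" "y \<in> mcball (snd st) (\<eta> * r)"
            "i \<in> J - {j}" "v i \<in> C" "close i (v i) j c x y"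
          using \<open>W2 c st\<close> by (auto simp: W2_def)
        obtain x' y' i' where xy': "x' \<in> mcball (fst st) (\<eta> * r)" "y' \<in> mcball (snd st) (\<eta> * r)"
            "i' \<in> J - {j}" "v i' \<in> C" "close i' (v i') j c' x' y'"
          using \<open>W2 c' st\<close> by (auto simp: W2_def)
        have iM: "i \<in> M" "i' \<in> M" "x \<in> M" "x' \<in> M"
          using xy xy' J(1) by auto
        have xi: "d x i < 2 * r" "d x' i' < 2 * r"
          using xy(5) xy'(5) pos r by (auto intro!: bump_pos simp: close_def)
        have "1 \<le> (real Q)\<^sup>2"
          using Q4096 by (intro one_le_power) simp
        then have "\<eta> \<le> 1"
          unfolding \<eta>_def by (subst divide_le_eq_1_pos) linarith+
        \<comment> \<open>The net pair also determines the other centre: \<open>x\<close> and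
          \<open>x'\<close> are within \<open>2 * r\<close> of each other, and each is within
          \<open>2 * r\<close> of its centre, so the centres are closer than \<open>6 * r\<close>.
          Hence both conflicts involve the same label \<open>v i\<close>.\<close>
        have "i' = i"
        proof (rule ccontr)
          assume "i' \<noteq> i"
          then have "10 * r \<le> d i' i"
            using J(2) xy(3) xy'(3) by auto
          moreover have "d i' i \<le> d i' x' + d x' x + d x i"
            using triangle[of i' x' i] triangle[of x' x i] iM by simp
          moreover have "d x' x \<le> 2 * \<eta> * r" "2 * \<eta> * r \<le> 2 * 1 * r"
            using near_ball[OF xy'(1) xy(1)] \<open>\<eta> \<le> 1\<close> r by auto
          ultimately show False
            using xi r commute[of i x] commute[of i' x'] by linarith
        qed
        show "\<bar>real (c m) / real Q - real (c' m) / real Q\<bar> < 1 / real Q" if m: "m < D" for m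
        proof -
          define b b' e e' w w' u where defs: "b = bump r j y" "b' = bump r j y'"
            "e = bump r i x" "e' = bump r i x'" "w = real (c m) / real Q" "w' = real (c' m) / real Q"
            "u = real (v i m) / real Q"
          have "c' \<in> C"
            using \<open>c' \<in> B2\<close> by (simp add: B2_def)
          have 1: "\<bar>(G m x + e * u) - (G m y + b * w)\<bar> < \<delta>" "\<bar>(G m x' + e' * u) - (G m y' + b' * w')\<bar> < \<delta>"
            using xy(5) xy'(5) m \<open>i' = i\<close> by (auto simp: close_def defs)
          have u: "\<bar>u\<bar> \<le> 1" "\<bar>w'\<bar> \<le> 1"
            using label_le[OF xy(4) m] label_le[OF \<open>c' \<in> C\<close> m] by (simp_all only: defs abs_of_nonneg)
          have "\<bar>e - e'\<bar> \<le> 2 * \<eta>" "\<bar>b - b'\<bar> \<le> 2 * \<eta>"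
            using near_bump[OF xy(1) xy'(1) iM(1)] near_bump[OF xy(2) xy'(2) jM] by (auto simp: defs)
          then have "\<bar>e - e'\<bar> * \<bar>u\<bar> \<le> 2 * \<eta> * 1" "\<bar>b - b'\<bar> * \<bar>w'\<bar> \<le> 2 * \<eta> * 1"
            using u pos by (auto simp only: intro!: mult_mono abs_ge_zero mult_nonneg_nonneg)
          then have 2: "\<bar>e * u - e' * u\<bar> \<le> 2 * \<eta>" "\<bar>b * w' - b' * w'\<bar> \<le> 2 * \<eta>"
            by (auto simp: abs_mult[symmetric] left_diff_distrib)
          \<comment> \<open>Two errors \<open>\<delta>\<close>, and \<open>2 * \<eta>\<close> for
            each of the two values of \<open>G\<close> and the two bump heights. Dividing by
            \<open>b\<close>, which is at least \<open>\<theta>\<close>, leaves a bound below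
            \<open>1 / Q\<close>.\<close>
          have "\<bar>b * w - b * w'\<bar> < 2 * \<delta> + 8 * \<eta>"
            using 1 2 near_G[OF xy(1) xy'(1) m] near_G[OF xy(2) xy'(2) m]
            unfolding abs_less_iff abs_le_iff by auto
          then have "b * \<bar>w - w'\<bar> < 2 * \<delta> + 8 * \<eta>"
            using bump_bounds(1)[of r j y] defs(1) by (simp add: abs_mult flip: right_diff_distrib)
          moreover have "\<theta> * \<bar>w - w'\<bar> \<le> b * \<bar>w - w'\<bar>"
            using xy(5) by (intro mult_right_mono) (auto simp: close_def defs)
          moreover have "2 * \<delta> + 8 * \<eta> < \<theta> * (1 / real Q)"
            using Q4096 by (simp add: \<delta>_def \<theta>_def \<eta>_def power2_eq_square field_simps)
          ultimately have "\<theta> * \<bar>w - w'\<bar> < \<theta> * (1 / real Q)"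
            by linarith
          then show ?thesis
            unfolding mult_less_cancel_left_pos[OF pos(2)] by (simp only: defs)
        qed
      qed (use that in \<open>auto simp: B2_def\<close>)
    qed (use T in auto)
    ultimately have "card (B1 \<union> B2) \<le> 2 * (card T * card T)"
      using card_Un_le[of B1 B2] by (simp add: card_cartesian_product)
    also have "\<dots> \<le> 2 * (Q ^ (9 * \<kappa>) * Q ^ (9 * \<kappa>))"
    proof -
      have "card T \<le> Q ^ (9 * \<kappa>)"
        using T(3) by (simp add: Q power_mult[symmetric] ac_simps)
      then show ?thesis
        by (intro mult_left_mono mult_mono) auto
    qed
    also have "\<dots> = 2 * Q ^ (18 * \<kappa>)"
      by (simp add: power_add[symmetric])
    \<comment> \<open>The two coordinates beyond \<open>18 * \<kappa>\<close> absorb the factor 2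
      that comes from having two kinds of constraints.\<close>
    also have "\<dots> < Q ^ 2 * Q ^ (18 * \<kappa>)"
      using Q4096 by (intro mult_strict_right_mono) (auto simp: power2_eq_square intro: less_le_trans[of 2 Q "Q * Q"])
    also have "\<dots> = card C"
      by (simp add: C D_def power_add power2_eq_square)
    finally have "\<not> C \<subseteq> B1 \<union> B2"
      using card_mono[of "B1 \<union> B2" C] C by (auto simp: B1_def B2_def)
    then show ?thesis
      unfolding B1_def B2_def by blast
  qed
  obtain v where v: "\<And>j. j \<in> J \<Longrightarrow> v j \<in> C \<and> \<not> bad j (v j)"
      "\<And>i j. i \<in> J \<Longrightarrow> j \<in> J \<Longrightarrow> i \<noteq> j \<Longrightarrow> \<not> conf i (v i) j (v j)"
    using greedy_labelling[of conf J C bad, OF conf_sym avail] by metis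
  define near where "near x j \<longleftrightarrow> j \<in> J \<and> d x j < 2 * r" for x j
  \<comment> \<open>The sum of bumps has at most one nonzero term at each point; \<open>SOME\<close>
    picks its centre, and the value is 0 where no centre is near.\<close>
  define f where "f m x = (if \<exists>j. near x j then bump r (SOME j. near x j) x * (real (v (SOME j. near x j) m) / real Q) else 0)"
    for m x
  have near_unique: "i = j" if "near x i" "near y j" "x \<in> M" "y \<in> M" "d x y < 6 * r" for x y i j
  proof (rule ccontr)
    assume "i \<noteq> j"
    have M: "i \<in> M" "j \<in> M"
      using that J(1) by (auto simp: near_def)
    have "10 * r \<le> d i j"
      using that \<open>i \<noteq> j\<close> J(2) by (auto simp: near_def)
    moreover have "d i j \<le> d x i + d x y + d y j"
      using triangle[of i x j] triangle[of x y j] M that by (simp add: commute)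
    ultimately show False
      using that r by (simp add: near_def)
  qed
  have f_near: "f m x = bump r j x * (real (v j m) / real Q)" if "near x j" "x \<in> M" for m x j
  proof -
    have "near x (SOME j. near x j)"
      using that(1) by (rule someI)
    then have "(SOME j. near x j) = j"
      using near_unique that r by (metis mdist_zero mult_pos_pos zero_less_numeral)
    then show ?thesis
      using that by (auto simp: f_def)
  qed
  have f_far: "f m x = 0" if "\<nexists>j. near x j" for m x
    using that by (simp add: f_def)
  have f_bounds: "0 \<le> f m x \<and> f m x \<le> 1" if "m < D" "x \<in> M" for m x
  proof (cases "\<exists>j. near x j")
    case True
    then obtain j where j: "near x j" ..
    then have "v j \<in> C"
      using v by (auto simp: near_def)
    then show ?thesis
      unfolding f_near[OF j that(2)] using label_le[of "v j" m] that(1) bump_bounds[of r j x]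
      by (intro conjI mult_nonneg_nonneg mult_le_one) auto
  qed (simp add: f_far)
  have f_lip_near: "\<bar>f m x - f m y\<bar> \<le> d x y / r"
    if "near x j" "m < D" "x \<in> M" "y \<in> M" "d x y < r" for m x y j
  proof -
    have jM: "j \<in> M" "v j \<in> C"
      using that J(1) v by (auto simp: near_def)
    \<comment> \<open>A centre near \<open>y\<close> must be \<open>j\<close>, because
      \<open>x\<close> and \<open>y\<close> are close. If there is none, both \<open>f m y\<close>
      and the bump of \<open>j\<close> at \<open>y\<close> vanish, so the same formula
      holds.\<close>
    have fy: "f m y = bump r j y * (real (v j m) / real Q)"
    proof (cases "\<exists>i. near y i")
      case True
      then show ?thesis
        using near_unique[of x j y] f_near that r by force
    next
      case False
      then have "2 * r \<le> d y j"
        using \<open>near x j\<close> by (auto simp: near_def not_less)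
      then show ?thesis
        using f_far[OF False] bump_eq_0[OF r] by simp
    qed
    have "f m x - f m y = (bump r j x - bump r j y) * (real (v j m) / real Q)"
      by (simp only: f_near[OF that(1,3)] fy left_diff_distrib)
    then have "\<bar>f m x - f m y\<bar> = \<bar>bump r j x - bump r j y\<bar> * (real (v j m) / real Q)"
      using label_le(2)[OF jM(2) that(2)] by (simp only: abs_mult abs_of_nonneg)
    also have "\<dots> \<le> (d x y / r) * 1"
      using bump_lipschitz[OF r that(3,4) jM(1)] label_le[OF jM(2) that(2)] r
      by (intro mult_mono) auto
    finally show ?thesis
      by simp
  qed
  have f_lip: "\<bar>f m x - f m y\<bar> \<le> d x y / r" if m: "m < D" and x: "x \<in> M" and y: "y \<in> M" for m x y
  proof -
    consider (far) "r \<le> d x y" | (x) j where "d x y < r" "near x j" | (y) j where "d x y < r" "near y j"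
      | (none) "\<nexists>j. near x j" "\<nexists>j. near y j"
      by (meson not_less)
    then show ?thesis
    proof cases
      case far
      then have "1 \<le> d x y / r"
        using r by simp
      then show ?thesis
        using f_bounds[OF m x] f_bounds[OF m y] by linarith
    next
      case x
      then show ?thesis
        using f_lip_near that by blast
    next
      case (y j)
      then have "\<bar>f m y - f m x\<bar> \<le> d y x / r"
        using f_lip_near[of y j m x] that by (simp add: commute)
      then show ?thesis
        by (simp add: commute abs_minus_commute)
    qed (use r in \<open>simp add: f_far\<close>)
  qed
  \<comment> \<open>If the bump at \<open>y\<close> is absent or below \<open>\<theta>\<close>, it
    uses up at most the part \<open>\<theta>\<close> of the margin granted by \<open>bad\<close>.
    Otherwise the absence of conflicts applies; the centre near \<open>y\<close> differs from
    \<open>j\<close> because \<open>x\<close> and \<open>y\<close> are at least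
    \<open>10 * r\<close> apart.\<close>
  have sep: "\<exists>m<D. \<delta> \<le> \<bar>(G m x + f m x) - (G m y + f m y)\<bar>"
    if j: "j \<in> J" and x: "x \<in> M" and y: "y \<in> M" and xj: "d x j \<le> r" and far: "10 * r \<le> d x y"
      and R: "d x y \<le> R" for j x y
  proof -
    have xnear: "near x j"
      using j xj r by (simp add: near_def)
    have fx: "f m x = real (v j m) / real Q" for m
      using f_near[OF xnear x] bump_eq_1[OF r xj] by simp
    obtain m where m: "m < D" "\<delta> + \<theta> \<le> \<bar>(G m x + real (v j m) / real Q) - G m y\<bar>"
      using v(1)[OF j] x y xj R unfolding bad_def by (auto simp: not_less)
    show ?thesis
    proof (cases "\<exists>i. near y i")
      case False
      then show ?thesis
        using m pos by (intro exI[of _ m]) (auto simp: fx f_far)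
    next
      case True
      then obtain i where i: "near y i" ..
      have iJ: "i \<in> J" "i \<in> M" "j \<in> M" "v i \<in> C" "v j \<in> C"
        using i J(1) j v by (auto simp: near_def)
      have "i \<noteq> j"
        using triangle[of x j y] i xj far r iJ x y by (auto simp: near_def commute)
      have fy: "f m y = bump r i y * (real (v i m) / real Q)" for m
        by (rule f_near[OF i y])
      show ?thesis
      proof (cases "\<theta> \<le> bump r i y")
        case True
        have "\<not> close j (v j) i (v i) x y"
          using v(2)[OF j iJ(1)] \<open>i \<noteq> j\<close> x y R iJ by (auto simp: conf_def)
        then show ?thesis
          using True bump_eq_1[OF r xj] pos by (auto simp: close_def fx fy not_less)
      next
        case False
        have "f m y \<le> bump r i y * 1"
          unfolding fy using label_le[OF iJ(4) m(1)] bump_bounds[of r i y] by (intro mult_left_mono) auto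
        then have "\<bar>f m y\<bar> \<le> \<theta>"
          using False f_bounds[OF m(1) y] by linarith
        then show ?thesis
          using m by (intro exI[of _ m]) (auto simp: fx)
      qed
    qed
  qed
  show thesis
    by (rule that[of f]) (use f_bounds f_lip sep in \<open>simp_all add: D_def \<delta>_def R_def\<close>)
qed

text \<open>Number of colours times coordinates per colour. Neither \<open>Q\<close> nor
  \<open>\<epsilon>\<close> occurs, which is the source of the uniform dimension.\<close>

definition embed_dim :: nat where
  "embed_dim = (2 ^ (6 * \<kappa>) + 1) * (18 * \<kappa> + 2)"

text \<open>One block of coordinates per colour, with \<open>k * D + m\<close> the
  \<open>m\<close>-th coordinate of colour \<open>k\<close>. Some net point lies within
  \<open>r\<close> of \<open>x\<close>, and the block of its colour separates \<open>x\<close> from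
  \<open>y\<close>.\<close>

lemma separating_step_all:
  fixes G :: "nat \<Rightarrow> 'a \<Rightarrow> real" and Q :: nat
  assumes r: "0 < r" and a: "12 \<le> a" and Q: "Q = 2 ^ a"
    and G: "\<forall>i<embed_dim. \<forall>x\<in>M. \<forall>y\<in>M. \<bar>G i x - G i y\<bar> \<le> d x y / r"
  shows "\<exists>f. (\<forall>i<embed_dim. \<forall>x\<in>M. 0 \<le> f i x \<and> f i x \<le> 1) \<and>
    (\<forall>i<embed_dim. \<forall>x\<in>M. \<forall>y\<in>M. \<bar>f i x - f i y\<bar> \<le> d x y / r) \<and>
    (\<forall>x\<in>M. \<forall>y\<in>M. 10 * r \<le> d x y \<longrightarrow> d x y \<le> 10 * real Q ^ 6 * r \<longrightarrow>
      (\<exists>i<embed_dim. 1 / (64 * (real Q)\<^sup>2) \<le> \<bar>(G i x + f i x) - (G i y + f i y)\<bar>))"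
proof -
  define D where "D = 18 * \<kappa> + 2"
  define L where "L = (2::nat) ^ (6 * \<kappa>) + 1"
  have dim: "embed_dim = L * D"
    by (simp add: embed_dim_def L_def D_def)
  have index: "k * D + m < embed_dim" if "k < L" "m < D" for k m
  proof -
    have "k * D + m < (k + 1) * D"
      using that by simp
    also have "\<dots> \<le> L * D"
      using that by (intro mult_right_mono) auto
    finally show ?thesis
      by (simp add: dim)
  qed
  obtain S col where S: "S \<subseteq> M" "\<And>x. x \<in> M \<Longrightarrow> \<exists>y\<in>S. d x y < r"
      "\<And>x. x \<in> S \<Longrightarrow> col x < L"
      "\<And>x y. x \<in> S \<Longrightarrow> y \<in> S \<Longrightarrow> x \<noteq> y \<Longrightarrow> col x = col y \<Longrightarrow> 10 * r \<le> d x y"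
    using coloured_net[OF r] unfolding L_def by blast
  define good where "good k f \<longleftrightarrow> (\<forall>m<D. \<forall>x\<in>M. 0 \<le> f m x \<and> f m x \<le> 1) \<and>
      (\<forall>m<D. \<forall>x\<in>M. \<forall>y\<in>M. \<bar>f m x - f m y\<bar> \<le> d x y / r) \<and>
      (\<forall>j\<in>S. \<forall>x\<in>M. \<forall>y\<in>M. col j = k \<longrightarrow> d x j \<le> r \<longrightarrow> 10 * r \<le> d x y \<longrightarrow> d x y \<le> 10 * real Q ^ 6 * r \<longrightarrow>
        (\<exists>m<D. 1 / (64 * (real Q)\<^sup>2) \<le> \<bar>(G (k * D + m) x + f m x) - (G (k * D + m) y + f m y)\<bar>))"
    for k f
  have ex_good: "\<exists>f. good k f"
    if k: "k < L" for k
  proof -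
    let ?J = "{x \<in> S. col x = k}"
    have JM: "?J \<subseteq> M"
      using S(1) by auto
    have Jsep: "10 * r \<le> d i j" if "i \<in> ?J" "j \<in> ?J" "i \<noteq> j" for i j
      using that S(4) by auto
    have Glip: "\<bar>G (k * D + m) x - G (k * D + m) y\<bar> \<le> d x y / r"
      if "m < 18 * \<kappa> + 2" "x \<in> M" "y \<in> M" for m x y
      using that index[OF k] G by (simp add: D_def)
    show ?thesis
      by (rule separating_step[OF r a Q JM Jsep Glip]) (assumption+, unfold good_def D_def, blast)
  qed
  define f where "f k = (SOME f. good k f)" for k
  have good: "good k (f k)" if "k < L" for k
    unfolding f_def using ex_good[OF that] by (rule someI_ex)
  have div_mod: "i div D < L" "i mod D < D" if "i < embed_dim" for i
    using that by (auto simp: dim D_def less_mult_imp_div_less)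
  show ?thesis
  proof (intro exI[of _ "\<lambda>i. f (i div D) (i mod D)"] conjI[of "All _"] allI ballI impI)
    show "\<exists>i<embed_dim. 1 / (64 * (real Q)\<^sup>2) \<le>
        \<bar>(G i x + f (i div D) (i mod D) x) - (G i y + f (i div D) (i mod D) y)\<bar>"
      if x: "x \<in> M" and y: "y \<in> M" and xy: "10 * r \<le> d x y" "d x y \<le> 10 * real Q ^ 6 * r" for x y
    proof -
      obtain j where j: "j \<in> S" "d x j < r"
        using S(2)[OF x] by blast
      have "col j < L"
        by (rule S(3)[OF j(1)])
      obtain m where m: "m < D" "1 / (64 * (real Q)\<^sup>2) \<le>
          \<bar>(G (col j * D + m) x + f (col j) m x) - (G (col j * D + m) y + f (col j) m y)\<bar>"
        using conjunct2[OF conjunct2[OF good[OF \<open>col j < L\<close>, unfolded good_def]],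
            rule_format, OF j(1) x y refl less_imp_le[OF j(2)] xy] by (elim exE conjE)
      then show ?thesis
        using index[OF S(3)[OF j(1)] m(1)] by (intro exI[of _ "col j * D + m"]) simp
    qed
    show "0 \<le> f (i div D) (i mod D) x \<and> f (i div D) (i mod D) x \<le> 1"
      if "i < embed_dim" "x \<in> M" for i x
      using good[OF div_mod(1)[OF that(1)]] div_mod(2)[OF that(1)] that(2) by (simp add: good_def)
    show "\<bar>f (i div D) (i mod D) x - f (i div D) (i mod D) y\<bar> \<le> d x y / r"
      if "i < embed_dim" "x \<in> M" "y \<in> M" for i x y
      using good[OF div_mod(1)[OF that(1)]] div_mod(2)[OF that(1)] that(2,3) by (simp add: good_def)
  qed
qed

end

section \<open>Combining all scales\<close>

text \<open>Take the least \<open>k\<close> with \<open>s / q ^ k \<le> t\<close>. Minimality gives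
  the last bound, except at \<open>k = 0\<close>, where there is no coarser scale to compare
  with.\<close>

lemma scale_exists:
  fixes s q t :: real
  assumes "0 < s" "1 < q" "s / q ^ n \<le> t"
  obtains k where "k \<le> n" "s / q ^ k \<le> t" "k = 0 \<or> t < q * (s / q ^ k)"
proof -
  define k where "k = (LEAST k. s / q ^ k \<le> t)"
  have k: "s / q ^ k \<le> t" "k \<le> n"
    unfolding k_def using assms(3) by (auto intro: LeastI Least_le)
  have "t < q * (s / q ^ k)" if "k \<noteq> 0"
  proof -
    obtain l where l: "k = Suc l"
      using not0_implies_Suc[OF \<open>k \<noteq> 0\<close>] by (elim exE)
    have "\<not> s / q ^ l \<le> t"
      using not_less_Least[of l "\<lambda>k. s / q ^ k \<le> t"] l unfolding k_def[symmetric] by simp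
    then show ?thesis
      using assms(2) by (simp add: l)
  qed
  then have "k = 0 \<or> t < q * (s / q ^ k)"
    by auto
  with k(2,1) show thesis
    by (rule that)
qed

context doubling_metric
begin

text \<open>Starting from 0, step \<open>k\<close> adds the map of
  \<open>separating_step_all\<close> times \<open>r k powr \<alpha>\<close>, so \<open>F n\<close>
  contains the scales below \<open>n\<close>. A pair at distance \<open>t\<close> is governed by the
  scale comparable to \<open>t\<close>: coarser scales are controlled by a Lipschitz bound, finer
  ones by a geometric series.\<close>

lemma multiscale_maps:
  fixes Q :: nat and q \<alpha> s :: real
  assumes a: "12 \<le> a" and Q: "Q = 2 ^ a" and q: "q = real Q ^ 6"
    and \<alpha>: "1 / 2 \<le> \<alpha>" "\<alpha> < 1" and growth: "2 \<le> q powr (1 - \<alpha>)" and s: "0 < s"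
  obtains F :: "nat \<Rightarrow> nat \<Rightarrow> 'a \<Rightarrow> real"
  where "\<And>n i x y. i < embed_dim \<Longrightarrow> x \<in> M \<Longrightarrow> y \<in> M \<Longrightarrow> x \<noteq> y \<Longrightarrow>
      \<bar>F n i x - F n i y\<bar> \<le> (q + 2) * d x y powr \<alpha>"
    and "\<And>n x y. x \<in> M \<Longrightarrow> y \<in> M \<Longrightarrow> 10 * (s / q ^ n) \<le> d x y \<Longrightarrow> d x y \<le> s \<Longrightarrow>
      \<exists>i<embed_dim. d x y powr \<alpha> / (1280 * real Q ^ 8) \<le> \<bar>F (Suc n) i x - F (Suc n) i y\<bar>"
proof -
  define \<delta> where "\<delta> = 1 / (64 * (real Q)\<^sup>2)"
  define r where "r k = s / q ^ k" for k
  have Q4096: "4096 \<le> Q"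
    using power_increasing[OF a, of "2::nat"] by (simp add: Q)
  have q1: "1 < q"
    using Q4096 by (simp add: q one_less_power)
  have r_pos: "0 < r k" for k
    using s q1 by (simp add: r_def)
  have r_Suc: "r k = q * r (Suc k)" for k
    using q1 by (simp add: r_def)
  have r_le: "r (Suc k) \<le> r k" for k
    using r_Suc[of k] r_pos[of "Suc k"] q1 by simp
  \<comment> \<open>The bump heights at least halve from scale to scale: since
    \<open>1 / 2 \<le> \<alpha>\<close>, \<open>q powr \<alpha>\<close> is no smaller than
    \<open>q powr (1 - \<alpha>)\<close>.\<close>
  have growth': "2 * r (Suc k) powr \<alpha> \<le> r k powr \<alpha>" for k
  proof -
    have "2 \<le> q powr \<alpha>"
      using growth q1 \<alpha> powr_mono[of "1 - \<alpha>" \<alpha> q] by linarith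
    then have "2 * r (Suc k) powr \<alpha> \<le> q powr \<alpha> * r (Suc k) powr \<alpha>"
      by (intro mult_right_mono) auto
    then show ?thesis
      using q1 r_pos[of "Suc k"] by (subst r_Suc) (simp add: powr_mult)
  qed
  \<comment> \<open>The allowed Lipschitz constant at least doubles at each step. This leaves room
    for the new bumps, whose Lipschitz bound equals that of the map they are added to.\<close>
  have decay: "2 * r k powr (\<alpha> - 1) \<le> r (Suc k) powr (\<alpha> - 1)" for k
  proof -
    have "2 * r k powr (\<alpha> - 1) \<le> q powr (1 - \<alpha>) * r k powr (\<alpha> - 1)"
      using growth by (intro mult_right_mono) auto
    also have "\<dots> = q powr (1 - \<alpha>) * q powr (\<alpha> - 1) * r (Suc k) powr (\<alpha> - 1)"
      using q1 r_pos[of "Suc k"] by (subst r_Suc) (simp add: powr_mult)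
    also have "\<dots> = r (Suc k) powr (\<alpha> - 1)"
      using q1 by (simp add: powr_add[symmetric])
    finally show ?thesis .
  qed
  have r_shift: "r k powr (\<alpha> - 1) = r k powr \<alpha> / r k" for k
    using r_pos[of k] by (simp add: powr_diff)

  \<comment> \<open>The invariant makes \<open>F\<close> divided by \<open>r k powr \<alpha>\<close>
    Lipschitz with constant \<open>1 / r k\<close>, as \<open>separating_step_all\<close> asks of
    \<open>G\<close>. The second conjunct pins down the start, for distances above the coarsest
    scale.\<close>
  define P where "P k F \<longleftrightarrow> (\<forall>i<embed_dim. \<forall>x\<in>M. \<forall>y\<in>M. \<bar>F i x - F i y\<bar> \<le> d x y * r k powr (\<alpha> - 1)) \<and>
      (k = 0 \<longrightarrow> F = (\<lambda>_ _. 0))"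
    for k and F :: "nat \<Rightarrow> 'a \<Rightarrow> real"
  define next_map where "next_map k F F' \<longleftrightarrow>
      (\<forall>i<embed_dim. \<forall>x\<in>M. 0 \<le> F' i x - F i x \<and> F' i x - F i x \<le> r k powr \<alpha>) \<and>
      (\<forall>x\<in>M. \<forall>y\<in>M. 10 * r k \<le> d x y \<longrightarrow> d x y \<le> 10 * q * r k \<longrightarrow>
        (\<exists>i<embed_dim. \<delta> * r k powr \<alpha> \<le> \<bar>F' i x - F' i y\<bar>))"
    for k and F F' :: "nat \<Rightarrow> 'a \<Rightarrow> real"
  have "\<exists>F. \<forall>k. P k (F k) \<and> next_map k (F k) (F (Suc k))"
  proof (rule dependent_nat_choice)
    show "\<exists>F. P 0 F"
      by (intro exI[of _ "\<lambda>_ _. 0"]) (simp add: P_def)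
    show "\<exists>F'. P (Suc k) F' \<and> next_map k F F'" if F: "P k F" for F k
    proof -
      define w where "w = r k powr \<alpha>"
      have w: "0 < w"
        using r_pos[of k] by (simp add: w_def)
      have Flip: "\<bar>F i x - F i y\<bar> \<le> d x y * (w / r k)" if "i < embed_dim" "x \<in> M" "y \<in> M" for i x y
        using F that by (auto simp: P_def r_shift w_def)
      have G: "\<forall>i<embed_dim. \<forall>x\<in>M. \<forall>y\<in>M. \<bar>F i x / w - F i y / w\<bar> \<le> d x y / r k"
      proof (intro allI impI ballI)
        fix i x y
        assume that: "i < embed_dim" "x \<in> M" "y \<in> M"
        have "\<bar>F i x / w - F i y / w\<bar> = \<bar>F i x - F i y\<bar> / w"
          using w by (simp add: diff_divide_distrib[symmetric] abs_divide)
        also have "\<dots> \<le> d x y * (w / r k) / w"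
          using Flip[OF that] w by (intro divide_right_mono) auto
        finally show "\<bar>F i x / w - F i y / w\<bar> \<le> d x y / r k"
          using w by simp
      qed
      obtain f where f: "\<forall>i<embed_dim. \<forall>x\<in>M. 0 \<le> f i x \<and> f i x \<le> 1"
          "\<forall>i<embed_dim. \<forall>x\<in>M. \<forall>y\<in>M. \<bar>f i x - f i y\<bar> \<le> d x y / r k"
          "\<forall>x\<in>M. \<forall>y\<in>M. 10 * r k \<le> d x y \<longrightarrow> d x y \<le> 10 * real Q ^ 6 * r k \<longrightarrow>
            (\<exists>i<embed_dim. 1 / (64 * (real Q)\<^sup>2) \<le> \<bar>(F i x / w + f i x) - (F i y / w + f i y)\<bar>)"
        using separating_step_all[where G = "\<lambda>i x. F i x / w", OF r_pos[of k] a Q G]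
        by (elim exE conjE)
      define F' where "F' i x = F i x + w * f i x" for i x
      have "P (Suc k) F'"
      proof -
        have "\<bar>F' i x - F' i y\<bar> \<le> d x y * r (Suc k) powr (\<alpha> - 1)"
          if "i < embed_dim" "x \<in> M" "y \<in> M" for i x y
        proof -
          have "\<bar>w * f i x - w * f i y\<bar> = w * \<bar>f i x - f i y\<bar>"
            using w by (simp add: abs_mult right_diff_distrib[symmetric])
          also have "\<dots> \<le> w * (d x y / r k)"
            using f(2)[rule_format, OF that] w by (intro mult_left_mono) auto
          also have "\<dots> = d x y * (w / r k)"
            by simp
          finally have "\<bar>F' i x - F' i y\<bar> \<le> d x y * (w / r k) + d x y * (w / r k)"
            using Flip[OF that] unfolding F'_def by linarith
          also have "\<dots> = d x y * (2 * r k powr (\<alpha> - 1))"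
            by (simp add: r_shift w_def)
          also have "\<dots> \<le> d x y * r (Suc k) powr (\<alpha> - 1)"
            using decay by (intro mult_left_mono) auto
          finally show ?thesis .
        qed
        then show ?thesis
          by (simp add: P_def)
      qed
      moreover have "next_map k F F'"
      proof -
        have "\<exists>i<embed_dim. \<delta> * w \<le> \<bar>F' i x - F' i y\<bar>"
          if xy: "x \<in> M" "y \<in> M" "10 * r k \<le> d x y" "d x y \<le> 10 * q * r k" for x y
        proof -
          obtain i where i: "i < embed_dim" "\<delta> \<le> \<bar>(F i x / w + f i x) - (F i y / w + f i y)\<bar>"
            using f(3)[rule_format, OF xy[unfolded q]] unfolding \<delta>_def by (elim exE conjE)
          have "\<delta> * w \<le> \<bar>(F i x / w + f i x) - (F i y / w + f i y)\<bar> * w"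
            using i(2) w by (intro mult_right_mono) auto
          also have "\<dots> = \<bar>((F i x / w + f i x) - (F i y / w + f i y)) * w\<bar>"
            using w by (simp add: abs_mult)
          also have "((F i x / w + f i x) - (F i y / w + f i y)) * w = F' i x - F' i y"
            using w by (simp add: F'_def algebra_simps)
          finally show ?thesis
            using i(1) by blast
        qed
        moreover have "0 \<le> F' i x - F i x \<and> F' i x - F i x \<le> w" if "i < embed_dim" "x \<in> M" for i x
          using f(1)[rule_format, OF that] w by (simp add: F'_def mult_left_le)
        ultimately show ?thesis
          by (simp add: next_map_def w_def)
      qed
      ultimately show ?thesis
        by blast
    qed
  qed
  then obtain F where P: "\<And>k. P k (F k)" and Fstep: "\<And>k. next_map k (F k) (F (Suc k))"
    by blast
  have lip: "\<bar>F k i x - F k i y\<bar> \<le> d x y * r k powr (\<alpha> - 1)" if "i < embed_dim" "x \<in> M" "y \<in> M" for k i x y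
    using P[of k] that by (simp add: P_def)
  have F0: "F 0 i x = 0" for i x
    using P[of 0] by (simp add: P_def)
  have tail: "\<bar>(F n i x - F n i y) - (F k i x - F k i y)\<bar> \<le> 2 * r k powr \<alpha>"
    if "k \<le> n" "i < embed_dim" "x \<in> M" "y \<in> M" for k n i x y
  proof -
    \<comment> \<open>The subtracted term closes the induction. Increments at \<open>x\<close> and
      \<open>y\<close> both lie between 0 and \<open>r n powr \<alpha>\<close>, so their difference
      costs that height once, and \<open>growth'\<close> pays for it.\<close>
    have "\<bar>(F n i x - F n i y) - (F k i x - F k i y)\<bar> \<le> 2 * r k powr \<alpha> - 2 * r n powr \<alpha>"
      using \<open>k \<le> n\<close>
    proof (induction n rule: dec_induct)
      case (step n)
      have "0 \<le> F (Suc n) i z - F n i z \<and> F (Suc n) i z - F n i z \<le> r n powr \<alpha>" if "z \<in> M" for z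
        using Fstep[of n] that \<open>i < embed_dim\<close> by (simp add: next_map_def)
      from this[OF \<open>x \<in> M\<close>] this[OF \<open>y \<in> M\<close>] show ?case
        using step.IH growth'[of n] by linarith
    qed simp
    then show ?thesis
      by (rule order_trans) simp
  qed
  show thesis
  proof (rule that[of F])
    fix n i x y
    assume i: "i < embed_dim" and x: "x \<in> M" and y: "y \<in> M" and "x \<noteq> y"
    define t where "t = d x y"
    have t: "0 < t"
      using x y \<open>x \<noteq> y\<close> by (simp add: t_def)
    have coarse: "t * r' powr (\<alpha> - 1) \<le> q * t powr \<alpha>" if r': "t \<le> q * r'" "0 < r'" for r'
    proof -
      have "r' powr (\<alpha> - 1) \<le> (t / q) powr (\<alpha> - 1)"
        using r' t q1 \<alpha> by (intro powr_mono2') (auto simp: field_simps)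
      also have "\<dots> = t powr (\<alpha> - 1) * q powr (1 - \<alpha>)"
        using t q1 powr_minus_divide[of q "\<alpha> - 1"] by (simp add: powr_divide)
      also have "\<dots> \<le> t powr (\<alpha> - 1) * q powr 1"
        using q1 \<alpha> by (intro mult_left_mono powr_mono) auto
      finally have "t * r' powr (\<alpha> - 1) \<le> t * (t powr (\<alpha> - 1) * q)"
        using t q1 by (intro mult_left_mono) auto
      also have "\<dots> = q * t powr \<alpha>"
        using t by (simp add: powr_diff)
      finally show ?thesis .
    qed
    \<comment> \<open>For \<open>t < r n\<close> the Lipschitz bound of \<open>F n\<close> suffices.
      Otherwise, at the first scale \<open>r k \<le> t\<close>, the Lipschitz bound handles
      \<open>F k\<close> and \<open>tail\<close> the rest; for \<open>k = 0\<close> the first part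
      is zero.\<close>
    have "\<bar>F n i x - F n i y\<bar> \<le> q * t powr \<alpha> + 2 * t powr \<alpha>"
    proof (cases "r n \<le> t")
      case False
      moreover have "1 * r n \<le> q * r n"
        using q1 r_pos[of n] by (intro mult_right_mono) auto
      ultimately have "t \<le> q * r n"
        by linarith
      then have "\<bar>F n i x - F n i y\<bar> \<le> q * t powr \<alpha>"
        using lip[OF i x y, of n] coarse[OF _ r_pos[of n]] by (auto simp: t_def)
      then show ?thesis
        using t by (simp add: add_increasing2)
    next
      case True
      obtain k where k: "k \<le> n" "r k \<le> t" "k = 0 \<or> t < q * r k"
        using scale_exists[OF s q1, of n t] True unfolding r_def by blast
      have "\<bar>F k i x - F k i y\<bar> \<le> q * t powr \<alpha>"
      proof (cases "k = 0")
        case True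
        then show ?thesis
          using q1 by (simp add: F0)
      next
        case False
        then show ?thesis
          using lip[OF i x y, of k] coarse[of "r k"] k(3) r_pos[of k] by (auto simp: t_def)
      qed
      moreover have "2 * r k powr \<alpha> \<le> 2 * t powr \<alpha>"
        using k(2) r_pos[of k] \<alpha> by (intro mult_left_mono powr_mono2) auto
      ultimately show ?thesis
        using tail[OF k(1) i x y] by linarith
    qed
    then show "\<bar>F n i x - F n i y\<bar> \<le> (q + 2) * d x y powr \<alpha>"
      by (simp add: t_def distrib_right)
  next
    fix n x y
    assume x: "x \<in> M" and y: "y \<in> M" and ge: "10 * (s / q ^ n) \<le> d x y" and le: "d x y \<le> s"
    have "s / q ^ n \<le> d x y / 10"
      using ge by linarith
    then obtain k where k: "k \<le> n" "r k \<le> d x y / 10" "k = 0 \<or> d x y / 10 < q * r k"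
      using scale_exists[OF s q1, of n "d x y / 10"] unfolding r_def by blast
    have upper: "d x y \<le> 10 * q * r k"
    proof (cases "k = 0")
      case True
      have "s * 1 \<le> s * (10 * q)"
        using s q1 by (intro mult_left_mono) auto
      then show ?thesis
        using True le by (simp add: r_def mult.commute)
    qed (use k(3) in auto)
    have "10 * r k \<le> d x y"
      using k(2) by simp
    with upper obtain i where i: "i < embed_dim" "\<delta> * r k powr \<alpha> \<le> \<bar>F (Suc k) i x - F (Suc k) i y\<bar>"
      using Fstep[of k] x y unfolding next_map_def by blast
    \<comment> \<open>The reason for \<open>q = Q ^ 6\<close>: as
      \<open>1 / 2 \<le> \<alpha>\<close>, one scale shrinks heights by at least
      \<open>Q ^ 3\<close>, which exceeds \<open>4 / \<delta> = 256 * Q ^ 2\<close>. All finer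
      scales together then destroy at most half of the separation.\<close>
    have small: "2 * r (Suc k) powr \<alpha> \<le> \<delta> / 2 * r k powr \<alpha>"
    proof -
      have "sqrt q = real Q ^ 3"
        by (rule real_sqrt_unique) (simp_all add: q power_mult[symmetric])
      then have "real Q ^ 3 = q powr (1 / 2)"
        using q1 by (simp add: powr_half_sqrt)
      also have "\<dots> \<le> q powr \<alpha>"
        using q1 \<alpha> by (intro powr_mono) auto
      finally have "real Q ^ 3 * r (Suc k) powr \<alpha> \<le> r k powr \<alpha>"
        using q1 r_pos[of "Suc k"] by (subst r_Suc) (simp add: powr_mult mult_right_mono)
      moreover have "256 * (real Q)\<^sup>2 * r (Suc k) powr \<alpha> \<le> real Q ^ 3 * r (Suc k) powr \<alpha>"
        using Q4096 by (intro mult_right_mono) (auto simp: power3_eq_cube power2_eq_square)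
      ultimately have "256 * (real Q)\<^sup>2 * r (Suc k) powr \<alpha> \<le> r k powr \<alpha>"
        by linarith
      then show ?thesis
        using Q4096 by (simp add: \<delta>_def field_simps)
    qed
    \<comment> \<open>The constant is \<open>10 * Q ^ 6\<close>, from
      \<open>d x y \<le> 10 * q * r k\<close>, times
      \<open>2 / \<delta> = 128 * Q ^ 2\<close>.\<close>
    have "d x y powr \<alpha> / (1280 * real Q ^ 8) \<le> \<delta> / 2 * r k powr \<alpha>"
    proof -
      have "d x y powr \<alpha> \<le> (10 * q * r k) powr \<alpha>"
        using upper \<alpha> by (intro powr_mono2) auto
      also have "\<dots> = (10 * q) powr \<alpha> * r k powr \<alpha>"
        using q1 r_pos[of k] by (simp add: powr_mult)
      also have "\<dots> \<le> (10 * q) powr 1 * r k powr \<alpha>"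
        using q1 \<alpha> by (intro mult_right_mono powr_mono) auto
      also have "\<dots> = 10 * real Q ^ 6 * r k powr \<alpha>"
        using q1 by (simp add: q)
      finally have "d x y powr \<alpha> / (1280 * real Q ^ 8) \<le> 10 * real Q ^ 6 * r k powr \<alpha> / (1280 * real Q ^ 8)"
        by (intro divide_right_mono) auto
      also have "\<dots> = \<delta> / 2 * r k powr \<alpha>"
      proof -
        have "real Q ^ 8 = real Q ^ 6 * (real Q)\<^sup>2"
          by (simp add: power_add[symmetric])
        moreover have "10 * A * w / (1280 * (A * B)) = 1 / (64 * B) / 2 * w" if "0 < A" "0 < B" for A B w :: real
          using that by simp
        ultimately show ?thesis
          using Q4096 unfolding \<delta>_def by (simp only: of_nat_0_less_iff zero_less_power)
      qed
      finally show ?thesis .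
    qed
    then have "d x y powr \<alpha> / (1280 * real Q ^ 8) \<le> \<bar>F (Suc n) i x - F (Suc n) i y\<bar>"
      using tail[of "Suc k" "Suc n" i x y] k(1) i x y small by linarith
    then show "\<exists>i<embed_dim. d x y powr \<alpha> / (1280 * real Q ^ 8) \<le> \<bar>F (Suc n) i x - F (Suc n) i y\<bar>"
      using i(1) by blast
  qed
qed

end

section \<open>Compactness and passage to a limit map\<close>

text \<open>A cluster point of the image filter replaces the limit of a subsequence: the compact set
  will be a product over a possibly uncountable index set, where convergent subsequences may fail to
  exist.\<close>

lemma cluster_point:
  fixes h :: "nat \<Rightarrow> 'b::topological_space"
  assumes "compact K" "\<And>n. h n \<in> K"
  shows "\<exists>z. \<forall>C. closed C \<longrightarrow> eventually (\<lambda>n. h n \<in> C) sequentially \<longrightarrow> z \<in> C"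
proof -
  have "filtermap h sequentially \<noteq> bot" "eventually (\<lambda>x. x \<in> K) (filtermap h sequentially)"
    using assms(2) by (auto simp: filtermap_bot_iff eventually_filtermap)
  then obtain z where z: "inf (nhds z) (filtermap h sequentially) \<noteq> bot"
    using \<open>compact K\<close> unfolding compact_filter by blast
  have "z \<in> C" if C: "closed C" and ev: "eventually (\<lambda>n. h n \<in> C) sequentially" for C
  proof (rule ccontr)
    assume "z \<notin> C"
    then have "eventually (\<lambda>x. x \<in> - C) (nhds z)"
      using C by (intro eventually_nhds_in_open) auto
    then have "eventually (\<lambda>_. False) (inf (nhds z) (filtermap h sequentially))"
      unfolding eventually_inf using ev
      by (intro exI[of _ "\<lambda>x. x \<in> - C"] exI[of _ "\<lambda>x. x \<in> C"]) (auto simp: eventually_filtermap)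
    then show False
      using z by (simp add: trivial_limit_def)
  qed
  then show ?thesis
    by blast
qed

lemma compact_PiE_intervals:
  fixes b :: "'i \<Rightarrow> real"
  shows "compact (\<Pi>\<^sub>E i\<in>UNIV. {- b i..b i})"
proof -
  have "compactin (product_topology (\<lambda>i. euclidean) UNIV) (\<Pi>\<^sub>E i\<in>UNIV. {- b i..b i})"
    by (subst compactin_PiE) (simp add: compactin_euclidean_iff)
  then show ?thesis
    by (simp add: euclidean_product_topology compactin_euclidean_iff)
qed

text \<open>Subtracting the value at a base point puts all maps into one compact product of
  intervals without changing differences. Both bounds pass to a cluster point because they define
  closed sets; for the lower bound this is a finite union over the coordinates.\<close>

lemma limit_of_maps:
  fixes H :: "nat \<Rightarrow> nat \<Rightarrow> 'a \<Rightarrow> real"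
  assumes upper: "\<And>p i x y. i < N \<Longrightarrow> x \<in> M \<Longrightarrow> y \<in> M \<Longrightarrow> \<bar>H p i x - H p i y\<bar> \<le> U x y"
    and lower: "\<And>x y. x \<in> M \<Longrightarrow> y \<in> M \<Longrightarrow> x \<noteq> y \<Longrightarrow>
      eventually (\<lambda>p. \<exists>i<N. L x y \<le> \<bar>H p i x - H p i y\<bar>) sequentially"
  shows "\<exists>F. (\<forall>i<N. \<forall>x\<in>M. \<forall>y\<in>M. \<bar>F i x - F i y\<bar> \<le> U x y) \<and>
    (\<forall>x\<in>M. \<forall>y\<in>M. x \<noteq> y \<longrightarrow> (\<exists>i<N. L x y \<le> \<bar>F i x - F i y\<bar>))"
proof (cases "M = {}")
  case False
  then obtain x0 where x0: "x0 \<in> M"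
    by blast
  define h where "h p = (\<lambda>(i, x). if i < N \<and> x \<in> M then H p i x - H p i x0 else 0)" for p
  define K :: "(nat \<times> 'a \<Rightarrow> real) set"
    where "K = (\<Pi>\<^sub>E ix\<in>UNIV. {- \<bar>U (snd ix) x0\<bar>..\<bar>U (snd ix) x0\<bar>})"
  have hK: "h p \<in> K" for p
  proof -
    have "\<bar>h p (i, x)\<bar> \<le> \<bar>U x x0\<bar>" for i x
      using upper[of i x x0 p] x0 by (auto simp: h_def)
    then show ?thesis
      unfolding K_def by (auto simp: PiE_iff abs_le_iff minus_le_iff)
  qed
  have "compact K"
    unfolding K_def by (rule compact_PiE_intervals)
  from cluster_point[of K h, OF this hK] obtain z
    where z: "\<forall>C. closed C \<longrightarrow> eventually (\<lambda>p. h p \<in> C) sequentially \<longrightarrow> z \<in> C" ..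
  have diff: "h p (i, x) - h p (i, y) = H p i x - H p i y" if "i < N" "x \<in> M" "y \<in> M" for p i x y
    using that by (simp add: h_def)
  have cont: "continuous_on UNIV (\<lambda>w :: nat \<times> 'a \<Rightarrow> real. \<bar>w (i, x) - w (i, y)\<bar>)" for i x y
    by (intro continuous_intros continuous_on_product_coordinates)
  have "\<bar>z (i, x) - z (i, y)\<bar> \<le> U x y" if "i < N" "x \<in> M" "y \<in> M" for i x y
  proof -
    have "z \<in> {w. \<bar>w (i, x) - w (i, y)\<bar> \<le> U x y}"
    proof (rule z[rule_format])
      show "closed {w :: nat \<times> 'a \<Rightarrow> real. \<bar>w (i, x) - w (i, y)\<bar> \<le> U x y}"
        by (intro closed_Collect_le cont continuous_on_const)
    qed (use upper diff that in simp)
    then show ?thesis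
      by simp
  qed
  moreover have "\<exists>i<N. L x y \<le> \<bar>z (i, x) - z (i, y)\<bar>" if "x \<in> M" "y \<in> M" "x \<noteq> y" for x y
  proof -
    have "z \<in> (\<Union>i<N. {w. L x y \<le> \<bar>w (i, x) - w (i, y)\<bar>})"
    proof (rule z[rule_format])
      show "closed (\<Union>i<N. {w :: nat \<times> 'a \<Rightarrow> real. L x y \<le> \<bar>w (i, x) - w (i, y)\<bar>})"
        by (intro closed_UN closed_Collect_le cont continuous_on_const ballI finite_lessThan)
      show "eventually (\<lambda>p. h p \<in> (\<Union>i<N. {w. L x y \<le> \<bar>w (i, x) - w (i, y)\<bar>})) sequentially"
        using lower[OF that] by (rule eventually_mono) (use diff that in auto)
    qed
    then show ?thesis
      by auto
  qed
  ultimately show ?thesis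
    by (intro exI[of _ "\<lambda>i x. z (i, x)"]) blast
qed auto

section \<open>Euclidean embeddings of snowflakes and choice of constants\<close>

context doubling_metric
begin

text \<open>With top scale \<open>p + 1\<close>, \<open>multiscale_maps\<close> handles the
  distances between \<open>1 / (p + 1)\<close> and \<open>p + 1\<close>. Every fixed pair of
  distinct points falls into this range for large \<open>p\<close>, so \<open>limit_of_maps\<close>
  gives one map for all pairs.\<close>

lemma snowflake_coordinates:
  fixes Q :: nat
  assumes a: "12 \<le> a" and Q: "Q = 2 ^ a"
    and \<epsilon>: "0 < \<epsilon>" "\<epsilon> < 1 / 2" and growth: "2 \<le> (real Q ^ 6) powr \<epsilon>"
  shows "\<exists>F. (\<forall>i<embed_dim. \<forall>x\<in>M. \<forall>y\<in>M. \<bar>F i x - F i y\<bar> \<le> (real Q ^ 6 + 2) * d x y powr (1 - \<epsilon>)) \<and>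
    (\<forall>x\<in>M. \<forall>y\<in>M. x \<noteq> y \<longrightarrow>
      (\<exists>i<embed_dim. d x y powr (1 - \<epsilon>) / (1280 * real Q ^ 8) \<le> \<bar>F i x - F i y\<bar>))"
proof -
  define good where "good p H \<longleftrightarrow>
      (\<forall>i<embed_dim. \<forall>x\<in>M. \<forall>y\<in>M. x \<noteq> y \<longrightarrow> \<bar>H i x - H i y\<bar> \<le> (real Q ^ 6 + 2) * d x y powr (1 - \<epsilon>)) \<and>
      (\<forall>x\<in>M. \<forall>y\<in>M. 1 / (real p + 1) \<le> d x y \<longrightarrow> d x y \<le> real p + 1 \<longrightarrow>
        (\<exists>i<embed_dim. d x y powr (1 - \<epsilon>) / (1280 * real Q ^ 8) \<le> \<bar>H i x - H i y\<bar>))"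
    for p :: nat and H :: "nat \<Rightarrow> 'a \<Rightarrow> real"
  have ex_good: "\<exists>H. good p H" for p
  proof -
    define s where "s = real p + 1"
    have s: "0 < s"
      by (simp add: s_def)
    have \<alpha>: "1 / 2 \<le> 1 - \<epsilon>" "1 - \<epsilon> < 1" "2 \<le> (real Q ^ 6) powr (1 - (1 - \<epsilon>))"
      using \<epsilon> growth by auto
    have "1 < real Q"
      using a by (simp add: Q)
    then have q1: "1 < real Q ^ 6"
      by (rule one_less_power) simp
    obtain F :: "nat \<Rightarrow> nat \<Rightarrow> 'a \<Rightarrow> real" where F:
      "\<And>n i x y. i < embed_dim \<Longrightarrow> x \<in> M \<Longrightarrow> y \<in> M \<Longrightarrow> x \<noteq> y \<Longrightarrow>
        \<bar>F n i x - F n i y\<bar> \<le> (real Q ^ 6 + 2) * d x y powr (1 - \<epsilon>)"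
      "\<And>n x y. x \<in> M \<Longrightarrow> y \<in> M \<Longrightarrow> 10 * (s / (real Q ^ 6) ^ n) \<le> d x y \<Longrightarrow> d x y \<le> s \<Longrightarrow>
        \<exists>i<embed_dim. d x y powr (1 - \<epsilon>) / (1280 * real Q ^ 8) \<le> \<bar>F (Suc n) i x - F (Suc n) i y\<bar>"
      by (rule multiscale_maps[OF a Q refl \<alpha> s]) (rule that)
    \<comment> \<open>Enough scales for the smallest distance covered,
      \<open>10 * (s / (real Q ^ 6) ^ n)\<close>, to be at most \<open>1 / s\<close>.\<close>
    obtain n where n: "10 * s * s < (real Q ^ 6) ^ n"
      using real_arch_pow[OF q1] by blast
    then have n': "10 * (s / (real Q ^ 6) ^ n) \<le> 1 / s"
    proof -
      have "0 < (real Q ^ 6) ^ n"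
        using q1 by (intro zero_less_power[of "real Q ^ 6"]) linarith
      then show ?thesis
        using n s by (simp only: field_simps) (simp add: mult.commute)
    qed
    have "good p (F (Suc n))"
      unfolding good_def s_def[symmetric]
    proof (intro conjI allI ballI impI)
      show "\<exists>i<embed_dim. d x y powr (1 - \<epsilon>) / (1280 * real Q ^ 8) \<le> \<bar>F (Suc n) i x - F (Suc n) i y\<bar>"
        if "x \<in> M" "y \<in> M" "1 / s \<le> d x y" "d x y \<le> s" for x y
        using that by (intro F(2) order_trans[OF n'])
    qed (rule F(1))
    then show ?thesis
      by (rule exI[of _ "F (Suc n)"])
  qed
  define H where "H p = (SOME H. good p H)" for p
  have H: "good p (H p)" for p
    unfolding H_def using ex_good by (rule someI_ex)
  show ?thesis
  proof (rule limit_of_maps[where H = H])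
    show "\<bar>H p i x - H p i y\<bar> \<le> (real Q ^ 6 + 2) * d x y powr (1 - \<epsilon>)"
      if "i < embed_dim" "x \<in> M" "y \<in> M" for p i x y
      using H[of p] that by (cases "x = y") (auto simp: good_def)
    show "eventually (\<lambda>p. \<exists>i<embed_dim. d x y powr (1 - \<epsilon>) / (1280 * real Q ^ 8) \<le>
        \<bar>H p i x - H p i y\<bar>) sequentially"
      if "x \<in> M" "y \<in> M" "x \<noteq> y" for x y
    proof -
      have pos: "0 < d x y"
        using that by simp
      have "eventually (\<lambda>p. nat \<lceil>d x y\<rceil> + nat \<lceil>1 / d x y\<rceil> \<le> p) sequentially"
        by (rule eventually_ge_at_top)
      then show ?thesis
      proof (rule eventually_mono)
        fix p :: nat
        assume "nat \<lceil>d x y\<rceil> + nat \<lceil>1 / d x y\<rceil> \<le> p"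
        then have "d x y \<le> real p" "1 / d x y \<le> real p"
          by linarith+
        then have "d x y \<le> real p + 1" "1 / (real p + 1) \<le> d x y"
          using pos by (auto simp: field_simps)
        then show "\<exists>i<embed_dim. d x y powr (1 - \<epsilon>) / (1280 * real Q ^ 8) \<le> \<bar>H p i x - H p i y\<bar>"
          using H[of p] that unfolding good_def by blast
      qed
    qed
  qed
qed

text \<open>Scaling by \<open>1280 * real Q ^ 8\<close> normalises the lower bound to 1. The
  Euclidean norm lies between the modulus of any one coordinate and the sum of all moduli, hence the
  factor \<open>embed_dim\<close>; the summand 2 makes it evident that the distortion constant
  exceeds 1.\<close>

lemma snowflake_embeds:
  fixes Q :: nat
  assumes "12 \<le> a" "Q = 2 ^ a" "0 < \<epsilon>" "\<epsilon> < 1 / 2" "2 \<le> (real Q ^ 6) powr \<epsilon>"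
  shows "embeds_with_distortion M (snowflake d \<epsilon>) (topspace (Euclidean_space embed_dim))
    (euclidean_norm embed_dim) (real embed_dim * (1280 * real Q ^ 8 * (real Q ^ 6 + 2)) + 2)"
proof -
  obtain F where F:
    "\<forall>i<embed_dim. \<forall>x\<in>M. \<forall>y\<in>M. \<bar>F i x - F i y\<bar> \<le> (real Q ^ 6 + 2) * d x y powr (1 - \<epsilon>)"
    "\<forall>x\<in>M. \<forall>y\<in>M. x \<noteq> y \<longrightarrow>
      (\<exists>i<embed_dim. d x y powr (1 - \<epsilon>) / (1280 * real Q ^ 8) \<le> \<bar>F i x - F i y\<bar>)"
    using snowflake_coordinates[OF assms] by (elim exE conjE)
  define c where "c = 1280 * real Q ^ 8"
  have c: "0 < c"
    using assms(2) by (simp add: c_def)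
  define f where "f x = (\<lambda>i. if i < embed_dim then c * F i x else 0)" for x
  have coord: "\<bar>(f x - f y) i\<bar> = c * \<bar>F i x - F i y\<bar>" if "i < embed_dim" for x y i
    using c that by (simp add: f_def abs_mult right_diff_distrib[symmetric])
  show ?thesis
    unfolding embeds_with_distortion_def
  proof (intro bexI[of _ f] ballI conjI)
    fix x y
    assume x: "x \<in> M" and y: "y \<in> M"
    show "snowflake d \<epsilon> x y \<le> euclidean_norm embed_dim (f x - f y)"
    proof (cases "x = y")
      case True
      then show ?thesis
        using y by (simp add: snowflake_def euclidean_norm_def)
    next
      case False
      obtain i where i: "i < embed_dim" "d x y powr (1 - \<epsilon>) / c \<le> \<bar>F i x - F i y\<bar>"
        using F(2)[rule_format, OF x y False] unfolding c_def by (elim exE conjE)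
      then have "snowflake d \<epsilon> x y \<le> c * \<bar>F i x - F i y\<bar>"
        using c by (simp add: snowflake_def pos_divide_le_eq mult.commute)
      also have "\<dots> \<le> \<bar>(f x - f y) i\<bar>"
        using coord[OF i(1)] by simp
      also have "\<dots> \<le> L2_set (\<lambda>i. \<bar>(f x - f y) i\<bar>) {..<embed_dim}"
        using i(1) by (intro member_le_L2_set) auto
      finally show ?thesis
        by (simp add: euclidean_norm_def L2_set_def)
    qed
    have bound: "\<bar>(f x - f y) i\<bar> \<le> c * ((real Q ^ 6 + 2) * d x y powr (1 - \<epsilon>))" if "i < embed_dim" for i
      unfolding coord[OF that] using F(1)[rule_format, OF that x y] c by (intro mult_left_mono) auto
    have "euclidean_norm embed_dim (f x - f y) \<le> (\<Sum>i<embed_dim. \<bar>(f x - f y) i\<bar>)"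
      unfolding euclidean_norm_def by (rule L2_set_le_sum_abs)
    also have "\<dots> \<le> (\<Sum>i<embed_dim. c * ((real Q ^ 6 + 2) * d x y powr (1 - \<epsilon>)))"
      by (rule sum_mono, rule bound) simp
    also have "\<dots> = (real embed_dim * (c * (real Q ^ 6 + 2))) * snowflake d \<epsilon> x y"
      by (simp add: snowflake_def)
    also have "\<dots> \<le> (real embed_dim * (c * (real Q ^ 6 + 2)) + 2) * snowflake d \<epsilon> x y"
      by (intro mult_right_mono) (auto simp: snowflake_def)
    finally show "euclidean_norm embed_dim (f x - f y) \<le>
        (real embed_dim * (1280 * real Q ^ 8 * (real Q ^ 6 + 2)) + 2) * snowflake d \<epsilon> x y"
      by (simp add: c_def)
  qed (auto simp: f_def topspace_Euclidean_space)
qed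

end

text \<open>The order of choices matters: \<open>\<kappa>\<close> comes from \<open>K\<close> alone
  and fixes the dimension. Only then does \<open>\<epsilon>\<close> enter, through an
  \<open>a\<close> with \<open>1 \<le> a * \<epsilon>\<close>, which makes \<open>Q = 2 ^ a\<close>
  large enough for the growth condition.\<close>

lemma snowflakes_embed_exists:
  "\<exists>N. \<forall>\<epsilon>\<in>{0<..<1/2}. \<exists>D>1. snowflakes_embed TYPE('a) K \<epsilon> N D"
proof -
  obtain \<kappa> where \<kappa>: "K < 2 ^ \<kappa>"
    using real_arch_pow[of 2 K] by auto
  show ?thesis
  proof (intro exI[of _ "doubling_metric.embed_dim \<kappa>"] ballI)
    fix \<epsilon> :: real
    assume \<epsilon>: "\<epsilon> \<in> {0<..<1/2}"
    define a where "a = max 12 (nat \<lceil>1 / \<epsilon>\<rceil>)"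
    define Q where "Q = (2::nat) ^ a"
    define D where "D = real (doubling_metric.embed_dim \<kappa>) * (1280 * real Q ^ 8 * (real Q ^ 6 + 2)) + 2"
    have a: "12 \<le> a" "1 / \<epsilon> \<le> real a"
      by (auto simp: a_def intro: order_trans[OF real_nat_ceiling_ge])
    have "1 \<le> real a * \<epsilon>"
      using a(2) \<epsilon> by (simp add: field_simps)
    then have "2 powr 1 \<le> 2 powr (real (a * 6) * \<epsilon>)"
      using \<epsilon> by (intro powr_mono) auto
    also have "\<dots> = (real Q ^ 6) powr \<epsilon>"
      by (simp add: Q_def powr_powr[symmetric] powr_realpow power_mult[symmetric])
    finally have growth: "2 \<le> (real Q ^ 6) powr \<epsilon>"
      by simp
    show "\<exists>D>1. snowflakes_embed TYPE('a) K \<epsilon> (doubling_metric.embed_dim \<kappa>) D"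
    proof (intro exI[of _ D] conjI)
      show "1 < D"
        unfolding D_def by (rule less_le_trans[of _ 2]) auto
      show "snowflakes_embed TYPE('a) K \<epsilon> (doubling_metric.embed_dim \<kappa>) D"
        unfolding snowflakes_embed_def
      proof (intro allI impI)
        fix X :: "'a set" and d
        assume "Metric_space X d" and dbl: "doubling_with X d K"
        interpret Metric_space X d by fact
        interpret doubling_metric X d \<kappa>
        proof
          fix x and r :: real
          assume "x \<in> X" "0 < r"
          then obtain A where A: "A \<subseteq> X" "finite A" "real (card A) \<le> K"
              "mcball x r \<subseteq> (\<Union>y\<in>A. mcball y (r / 2))"
            using dbl unfolding doubling_with_def by blast
          have "real (card A) \<le> real (2 ^ \<kappa>)"
            unfolding of_nat_power of_nat_numeral using A(3) \<kappa> by linarith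
          then show "\<exists>A\<subseteq>X. finite A \<and> card A \<le> 2 ^ \<kappa> \<and> mcball x r \<subseteq> (\<Union>y\<in>A. mcball y (r / 2))"
            using A unfolding of_nat_le_iff by blast
        qed
        show "embeds_with_distortion X (snowflake d \<epsilon>) (topspace (Euclidean_space (doubling_metric.embed_dim \<kappa>)))
            (euclidean_norm (doubling_metric.embed_dim \<kappa>)) D"
          unfolding D_def using \<epsilon> by (intro snowflake_embeds[OF a(1) Q_def _ _ growth]) auto
      qed
    qed
  qed
qed

section \<open>Transfer from real carriers to arbitrary types\<close>

text \<open>A point \<open>x\<close> is encoded by the pairs \<open>(s, q)\<close> of a dense point
  and a rational with \<open>d x s < q\<close>. For \<open>y\<close> distinct from \<open>x\<close>,
  a pair with \<open>d x s < q < d x y / 2\<close> belongs to \<open>x\<close> but not to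
  \<open>y\<close>. Subsets of a countable set are then coded as sets of naturals and finally as
  reals.\<close>

lemma (in Metric_space) separable_inj_real:
  assumes "separable_space mtopology"
  obtains g :: "'a \<Rightarrow> real" where "inj_on g M"
proof -
  obtain S where S: "countable S" "S \<subseteq> M" "mtopology closure_of S = M"
    using assms by (auto simp: separable_space_def)
  define T where "T = S \<times> (\<rat> :: real set)"
  have T: "countable T"
    using S(1) by (simp add: T_def countable_rat)
  define \<phi> where "\<phi> x = {(s, q) \<in> T. d x s < q}" for x
  have "x = y" if x: "x \<in> M" and y: "y \<in> M" and eq: "\<phi> x = \<phi> y" for x y
  proof (rule ccontr)
    assume "x \<noteq> y"
    then have "0 < d x y / 2"
      using x y by simp
    moreover have "x \<in> mtopology closure_of S"
      using x S(3) by simp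
    ultimately obtain s where s: "s \<in> S" "s \<in> mball x (d x y / 2)"
      unfolding metric_closure_of by blast
    then obtain q where q: "q \<in> \<rat>" "d x s < q" "q < d x y / 2"
      using Rats_dense_in_real[of "d x s" "d x y / 2"] by auto
    have "(s, q) \<in> \<phi> x"
      using s q by (simp add: \<phi>_def T_def)
    then have "(s, q) \<in> \<phi> y"
      by (simp only: eq)
    then have "d y s < q"
      by (simp add: \<phi>_def)
    then show False
      using triangle[of x s y] s q x y by (simp add: commute)
  qed
  then have inj: "inj_on \<phi> M"
    by (rule inj_onI)
  have sub: "\<phi> x \<subseteq> T" for x
    by (auto simp: \<phi>_def)
  have "inj_on (\<lambda>x. to_nat_on T ` \<phi> x) M"
  proof (rule inj_onI)
    fix x y
    assume "x \<in> M" "y \<in> M" and eq: "to_nat_on T ` \<phi> x = to_nat_on T ` \<phi> y"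
    moreover have "\<phi> x = \<phi> y"
      using eq inj_on_image_eq_iff[OF inj_on_to_nat_on[OF T] sub sub] by simp
    ultimately show "x = y"
      using inj by (simp add: inj_on_def)
  qed
  moreover obtain e :: "nat set \<Rightarrow> real" where "inj e"
    using nat_sets_lepoll_reals01 unfolding lepoll_def by blast
  ultimately have "inj_on (e \<circ> (\<lambda>x. to_nat_on T ` \<phi> x)) M"
    by (intro comp_inj_on) (auto intro: inj_on_subset)
  then show thesis
    by (rule that)
qed

text \<open>The metric is carried over to the image of an injection \<open>g\<close> into the reals.
  Balls correspond under \<open>g\<close>, so separability and doubling go over, and the embedding
  of the image is composed with \<open>g\<close>.\<close>

lemma snowflakes_embed_transfer:
  assumes "snowflakes_embed TYPE(real) K \<epsilon> N D"
  shows "snowflakes_embed TYPE('a) K \<epsilon> N D"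
  unfolding snowflakes_embed_def
proof (intro allI impI)
  fix X :: "'a set" and d
  assume "Metric_space X d" and two: "\<exists>x\<in>X. \<exists>y\<in>X. x \<noteq> y"
    and sep: "separable_space (Metric_space.mtopology X d)" and dbl: "doubling_with X d K"
  interpret Metric_space X d by fact
  obtain g :: "'a \<Rightarrow> real" where g: "inj_on g X"
    using separable_inj_real[OF sep] by blast
  define h where "h = inv_into X g"
  have hg: "h (g x) = x" if "x \<in> X" for x
    using g that by (simp add: h_def)
  \<comment> \<open>Off the image of \<open>g\<close> the values of \<open>h\<close> are arbitrary,
    but \<open>d'\<close> remains nonnegative and symmetric there, as the locale asks, because
    \<open>d\<close> has these properties on the whole type.\<close>
  define d' where "d' u v = d (h u) (h v)" for u v
  interpret Y: Metric_space "g ` X" d'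
    by unfold_locales (auto simp: d'_def hg commute triangle)
  have mball: "Y.mball (g x) r = g ` mball x r" if "x \<in> X" for x r
    using that by (auto simp: d'_def hg)
  have mcball: "Y.mcball (g x) r = g ` mcball x r" if "x \<in> X" for x r
    using that by (auto simp: d'_def hg)
  have "separable_space Y.mtopology"
  proof -
    obtain S where S: "countable S" "S \<subseteq> X" "mtopology closure_of S = X"
      using sep by (auto simp: separable_space_def)
    have "\<exists>y\<in>g ` S. y \<in> Y.mball (g x) r" if "x \<in> X" "0 < r" for x r
    proof -
      have "x \<in> mtopology closure_of S"
        using that S(3) by simp
      then obtain s where "s \<in> S" "s \<in> mball x r"
        unfolding metric_closure_of using \<open>0 < r\<close> by blast
      then show ?thesis
        unfolding mball[OF that(1)] by blast
    qed
    then have "Y.mtopology closure_of (g ` S) = g ` X"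
      by (auto simp: Y.metric_closure_of)
    then show ?thesis
      unfolding separable_space_def using S(1,2) by (intro exI[of _ "g ` S"]) auto
  qed
  moreover have "doubling_with (g ` X) d' K"
    unfolding doubling_with_def
  proof (intro conjI ballI allI impI)
    show "1 < K"
      using dbl by (simp add: doubling_with_def)
    fix u and r :: real
    assume "u \<in> g ` X" "0 < r"
    then obtain x where x: "x \<in> X" "u = g x"
      by blast
    obtain A where A: "A \<subseteq> X" "finite A" "real (card A) \<le> K" "mcball x r \<subseteq> (\<Union>y\<in>A. mcball y (r / 2))"
      using dbl x(1) \<open>0 < r\<close> unfolding doubling_with_def by blast
    have "Y.mcball u r \<subseteq> (\<Union>v\<in>g ` A. Y.mcball v (r / 2))"
    proof -
      have "Y.mcball u r \<subseteq> g ` (\<Union>y\<in>A. mcball y (r / 2))"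
        unfolding x(2) mcball[OF x(1)] using A(4) by (rule image_mono)
      also have "\<dots> \<subseteq> (\<Union>v\<in>g ` A. Y.mcball v (r / 2))"
        using A(1) mcball by blast
      finally show ?thesis .
    qed
    moreover have "real (card (g ` A)) \<le> K"
      using card_image_le[OF A(2), of g] A(3) by linarith
    ultimately show "\<exists>A\<subseteq>g ` X. finite A \<and> real (card A) \<le> K \<and> Y.mcball u r \<subseteq> (\<Union>v\<in>A. Y.mcball v (r / 2))"
      using A(1,2) by (intro exI[of _ "g ` A"]) auto
  qed
  moreover have "\<exists>u\<in>g ` X. \<exists>v\<in>g ` X. u \<noteq> v"
    using two g by (auto simp: inj_on_def)
  ultimately have "embeds_with_distortion (g ` X) (snowflake d' \<epsilon>) (topspace (Euclidean_space N)) (euclidean_norm N) D"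
    using assms Y.Metric_space_axioms unfolding snowflakes_embed_def by blast
  then obtain f where f: "f \<in> g ` X \<rightarrow> topspace (Euclidean_space N)"
      "\<forall>u\<in>g ` X. \<forall>v\<in>g ` X. snowflake d' \<epsilon> u v \<le> euclidean_norm N (f u - f v) \<and>
        euclidean_norm N (f u - f v) \<le> D * snowflake d' \<epsilon> u v"
    unfolding embeds_with_distortion_def by blast
  have "snowflake d' \<epsilon> (g x) (g y) = snowflake d \<epsilon> x y" if "x \<in> X" "y \<in> X" for x y
    using that by (simp add: snowflake_def d'_def hg)
  then show "embeds_with_distortion X (snowflake d \<epsilon>) (topspace (Euclidean_space N)) (euclidean_norm N) D"
    unfolding embeds_with_distortion_def using f by (intro bexI[of _ "\<lambda>x. f (g x)"]) auto
qed

theorem theorem1p2: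
  shows "(\<forall>K>0. \<exists>N. \<forall>\<epsilon>\<in>{0<..<1/2}. \<exists>D>1. snowflakes_embed TYPE(real) K \<epsilon> N D) \<and>
    (\<forall>K>0. \<forall>N. \<forall>\<epsilon>\<in>{0<..<1/2}. \<forall>D>1.
       snowflakes_embed TYPE(real) K \<epsilon> N D \<longrightarrow> snowflakes_embed TYPE('a) K \<epsilon> N D)"
  using snowflakes_embed_exists snowflakes_embed_transfer by blast

end
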